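(* If $p\in\Sigma$ is a regular-cusp tangential singularity or a saddle-node pseudo-equilibrium of the planar Filippov vector field $Z=(F^+,F^-)_f$, then $I_p(Z)=0$.
   Context: "Smooth" means $C^l$ with $l\ge 1$ large enough for the derivatives below to exist. For $u,v\in\mathbb{R}^2$, $(u|v)$ is the matrix with columns $u,v$. Planar Filippov vector field: $D\subset\mathbb{R}^2$ is open; $f:D\to\mathbb{R}$ is smooth with $0$ as a regular value; coordinates $(x,y)$ are such that $\Sigma:=f^{-1}(0)=D\cap\{y=0\}$, $f>0$ on $D\cap\{y>0\}$ and $f<0$ on $D\cap\{y<0\}$. Put $\Sigma^+=\{f\ge 0\}$, $\Sigma^-=\{f\le 0\}$. $F^\pm:D\to\mathbb{R}^2$ are smooth, and $Z=(F^+,F^-)_f$ equals $F^+$ on $\Sigma^+$ and $F^-$ on $\Sigma^-$ (two-valued on $\Sigma$), with Filippov's convention on $\Sigma$. Write $Ff(\mathbf{x})=\langle\nabla f(\mathbf{x}),F(\mathbf{x})\rangle$ and $F^{n}f=F(F^{n-1}f)$. $\Sigma^s=\{\mathbf{x}\in\Sigma:F^+f<0,\ F^-f>0\}$, $\Sigma^e=\{\mathbf{x}\in\Sigma:F^+f>0,\ F^-f<0\}$, and on $\Sigma^{s,e}=\Sigma^s\cup\Sigma^e$ the sliding vector field is $Z^s=\dfrac{F^-f\,F^+-F^+f\,F^-}{F^-f-F^+f}$, which is tangent to $\Sigma$ and is regarded as a scalar (its first component) function of $x$; primes denote derivatives with respect to $x$. Singularities: $\mathbf{x}_0\in D$ is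 a singularity of $Z$ if (a) $\mathbf{x}_0\in\Sigma^+$ and $F^+(\mathbf{x}_0)=0$, or $\mathbf{x}_0\in\Sigma^-$ and $F^-(\mathbf{x}_0)=0$; or (b) $\mathbf{x}_0\in\Sigma^s\cup\Sigma^e$ and $Z^s(\mathbf{x}_0)=0$; or (c) $\mathbf{x}_0\in\Sigma$ and $F^+f(\mathbf{x}_0)=0$ or $F^-f(\mathbf{x}_0)=0$. Regular-cusp tangential singularity: $p\in\Sigma$ with $F^+f(p)=(F^+)^2f(p)=0$, $(F^+)^3f(p)\ne0$, $F^-f(p)\ne0$ (or the same with the roles of $F^+$ and $F^-$ exchanged). Saddle-node pseudo-equilibrium: $p\in\Sigma^{s,e}$ with $Z^s(p)=(Z^s)'(p)=0$ and $(Z^s)''(p)\ne0$. Index on a circle: let $B=B_r(\mathbf{x}_0)\subset D$ be a closed ball with center $\mathbf{x}_0=(a,b)$ and no singularities of $Z$ on $\partial B$. Define $$I_{\partial B}(Z)=\frac1{2\pi}\Big(J^+_{\partial B}(Z)+J^-_{\partial B}(Z)+\int_{\Gamma^+}\omega_W+\int_{\Gamma^-}\omega_W\Big),\quad \omega_W=\frac{-y\,dx+x\,dy}{x^2+y^2},$$ where $\Gamma^\pm$ is the image under $F^\pm$ of $\partial B\cap\Sigma^\pm$, traversed counterclockwise along $\partial B$, and $J^\pm_{\partial B}(Z)$ is as follows. If $|b|<r$, let $p^\pm=(a\pm\sqrt{r^2-b^2},0)$ be the right/left points of $\partial B\cap\Sigma$ (these are $(\pm r,0)$ when $\mathbf{x}_0=(0,0)$).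 If $\det(F^+(p^\pm)|F^-(p^\pm))=0$ then $J^\pm_{\partial B}(Z)=0$; otherwise $$J^\pm_{\partial B}(Z)=\pm\big(\tan^{-1}H_{(F^+,F^-)}(p^\pm)-\tan^{-1}H_{(F^-,F^+)}(p^\pm)\big),\quad H_{(F,G)}=\frac{\|F\|^2-\langle F,G\rangle}{\det(G|F)}.$$ If $|b|\ge r$, $J^\pm_{\partial B}(Z)=0$. Index at an isolated singularity $\mathbf{x}_0$: $I_{\mathbf{x}_0}(Z):=I_{\partial B_r(\mathbf{x}_0)}(Z)$ for any $r>0$ such that $\mathbf{x}_0$ is the unique singularity in $B_r(\mathbf{x}_0)\subset D$. *)

theory Defs
  imports "HOL-Analysis.Analysis"
begin

type_synonym plane = "real^2"

(* On an open set D this is the usual class C^k. *)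
primrec Ck_on :: "nat \<Rightarrow> (real^'n \<Rightarrow> 'b::real_normed_vector) \<Rightarrow> (real^'n) set \<Rightarrow> bool" where
  "Ck_on 0 g D \<longleftrightarrow> continuous_on D g"
| "Ck_on (Suc k) g D \<longleftrightarrow>
     (\<forall>x\<in>D. g differentiable (at x)) \<and>
     (\<forall>i. Ck_on k (\<lambda>x. frechet_derivative g (at x) (axis i 1)) D)"

definition grad :: "(plane \<Rightarrow> real) \<Rightarrow> plane \<Rightarrow> plane" where
  "grad g x = (\<chi> i. frechet_derivative g (at x) (axis i 1))"

(* Ff = lie F f, and F^n f = (lie F ^^ n) f. *)
definition lie :: "(plane \<Rightarrow> plane) \<Rightarrow> (plane \<Rightarrow> real) \<Rightarrow> plane \<Rightarrow> real" where
  "lie F g x = grad g x \<bullet> F x"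

(* det (u|v); the library's vector builds the matrix from its rows. *)
definition det_cols :: "plane \<Rightarrow> plane \<Rightarrow> real" where
  "det_cols u v = det (transpose (vector [u, v] :: real^2^2))"

(* Z = (F^+, F^-)_f with F^+ = upper Z, F^- = lower Z, f = switch Z, D = region Z. The values
   of these total functions outside D play no role. *)
record filippov =
  region :: "plane set"
  switch :: "plane \<Rightarrow> real"
  upper  :: "plane \<Rightarrow> plane"
  lower  :: "plane \<Rightarrow> plane"

definition Sigma_set :: "filippov \<Rightarrow> plane set" where
  "Sigma_set Z = {x \<in> region Z. switch Z x = 0}"

definition Sigma_pos :: "filippov \<Rightarrow> plane set" where
  "Sigma_pos Z = {x \<in> region Z. switch Z x \<ge> 0}"

definition Sigma_neg :: "filippov \<Rightarrow> plane set" where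
  "Sigma_neg Z = {x \<in> region Z. switch Z x \<le> 0}"

definition planar_filippov :: "nat \<Rightarrow> filippov \<Rightarrow> bool" where
  "planar_filippov l Z \<longleftrightarrow>
     open (region Z) \<and>
     Ck_on l (switch Z) (region Z) \<and>
     Ck_on l (upper Z) (region Z) \<and>
     Ck_on l (lower Z) (region Z) \<and>
     (\<forall>x\<in>region Z. switch Z x = 0 \<longrightarrow> grad (switch Z) x \<noteq> 0) \<and>
     Sigma_set Z = region Z \<inter> {x. x $ 2 = 0} \<and>
     (\<forall>x\<in>region Z. x $ 2 > 0 \<longrightarrow> switch Z x > 0) \<and>
     (\<forall>x\<in>region Z. x $ 2 < 0 \<longrightarrow> switch Z x < 0)"

definition sliding_set :: "filippov \<Rightarrow> plane set" where
  "sliding_set Z =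
     {x \<in> Sigma_set Z. lie (upper Z) (switch Z) x < 0 \<and> lie (lower Z) (switch Z) x > 0}"

definition escaping_set :: "filippov \<Rightarrow> plane set" where
  "escaping_set Z =
     {x \<in> Sigma_set Z. lie (upper Z) (switch Z) x > 0 \<and> lie (lower Z) (switch Z) x < 0}"

definition sliding_field :: "filippov \<Rightarrow> plane \<Rightarrow> plane" where
  "sliding_field Z x =
     (lie (lower Z) (switch Z) x *\<^sub>R upper Z x - lie (upper Z) (switch Z) x *\<^sub>R lower Z x)
       /\<^sub>R (lie (lower Z) (switch Z) x - lie (upper Z) (switch Z) x)"

(* The sliding vector field regarded as a scalar function of the coordinate x on Sigma. *)
definition sliding_scalar :: "filippov \<Rightarrow> real \<Rightarrow> real" where
  "sliding_scalar Z s = sliding_field Z (vector [s, 0]) $ 1"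

definition singularity :: "filippov \<Rightarrow> plane \<Rightarrow> bool" where
  "singularity Z x \<longleftrightarrow>
     (x \<in> Sigma_pos Z \<and> upper Z x = 0 \<or> x \<in> Sigma_neg Z \<and> lower Z x = 0) \<or>
     (x \<in> sliding_set Z \<union> escaping_set Z \<and> sliding_field Z x = 0) \<or>
     (x \<in> Sigma_set Z \<and> (lie (upper Z) (switch Z) x = 0 \<or> lie (lower Z) (switch Z) x = 0))"

definition cusp_regular_pair ::
    "(plane \<Rightarrow> plane) \<Rightarrow> (plane \<Rightarrow> plane) \<Rightarrow> (plane \<Rightarrow> real) \<Rightarrow> plane \<Rightarrow> bool" where
  "cusp_regular_pair F G g p \<longleftrightarrow>
     lie F g p = 0 \<and> (lie F ^^ 2) g p = 0 \<and> (lie F ^^ 3) g p \<noteq> 0 \<and> lie G g p \<noteq> 0"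

definition regular_cusp :: "filippov \<Rightarrow> plane \<Rightarrow> bool" where
  "regular_cusp Z p \<longleftrightarrow> p \<in> Sigma_set Z \<and>
     (cusp_regular_pair (upper Z) (lower Z) (switch Z) p \<or>
      cusp_regular_pair (lower Z) (upper Z) (switch Z) p)"

definition saddle_node_pseudo_equilibrium :: "filippov \<Rightarrow> plane \<Rightarrow> bool" where
  "saddle_node_pseudo_equilibrium Z p \<longleftrightarrow> p \<in> sliding_set Z \<union> escaping_set Z \<and>
     sliding_scalar Z (p $ 1) = 0 \<and>
     deriv (sliding_scalar Z) (p $ 1) = 0 \<and>
     deriv (deriv (sliding_scalar Z)) (p $ 1) \<noteq> 0"

definition circle_at :: "plane \<Rightarrow> real \<Rightarrow> real \<Rightarrow> plane" where
  "circle_at x0 r t = x0 + r *\<^sub>R vector [cos t, sin t]"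

(* The form (-y dx + x dy) / (x^2 + y^2) at the point w, applied to the tangent vector v. *)
definition angle_form :: "plane \<Rightarrow> plane \<Rightarrow> real" where
  "angle_form w v = (- (w $ 2) * v $ 1 + w $ 1 * v $ 2) / ((w $ 1)\<^sup>2 + (w $ 2)\<^sup>2)"

(* Integral of angle_form along the image under F of the part of the circle lying in S,
   traversed counterclockwise. As S is used only for the sets f >= 0 and f <= 0, the parameter
   set is a finite union of intervals: when the arc contains the angle 0 in its interior it
   appears as two pieces. *)
definition angle_integral :: "(plane \<Rightarrow> plane) \<Rightarrow> plane set \<Rightarrow> plane \<Rightarrow> real \<Rightarrow> real" where
  "angle_integral F S x0 r =
     integral {t \<in> {0..2 * pi}. circle_at x0 r t \<in> S}
       (\<lambda>t. angle_form (F (circle_at x0 r t))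
              (vector_derivative (\<lambda>s. F (circle_at x0 r s)) (at t)))"

definition H_quot :: "(plane \<Rightarrow> plane) \<Rightarrow> (plane \<Rightarrow> plane) \<Rightarrow> plane \<Rightarrow> real" where
  "H_quot F G q = ((norm (F q))\<^sup>2 - F q \<bullet> G q) / det_cols (G q) (F q)"

definition jump :: "filippov \<Rightarrow> plane \<Rightarrow> real" where
  "jump Z q =
     (if det_cols (upper Z q) (lower Z q) = 0 then 0
      else arctan (H_quot (upper Z) (lower Z) q) - arctan (H_quot (lower Z) (upper Z) q))"

definition J_right :: "filippov \<Rightarrow> plane \<Rightarrow> real \<Rightarrow> real" where
  "J_right Z x0 r =
     (if \<bar>x0 $ 2\<bar> < r then jump Z (vector [x0 $ 1 + sqrt (r\<^sup>2 - (x0 $ 2)\<^sup>2), 0]) else 0)"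

definition J_left :: "filippov \<Rightarrow> plane \<Rightarrow> real \<Rightarrow> real" where
  "J_left Z x0 r =
     (if \<bar>x0 $ 2\<bar> < r then - jump Z (vector [x0 $ 1 - sqrt (r\<^sup>2 - (x0 $ 2)\<^sup>2), 0]) else 0)"

(* Meaningful when cball x0 r lies in the region and Z has no singularity on sphere x0 r. *)
definition circle_index :: "filippov \<Rightarrow> plane \<Rightarrow> real \<Rightarrow> real" where
  "circle_index Z x0 r =
     1 / (2 * pi) *
       (J_right Z x0 r + J_left Z x0 r
        + angle_integral (upper Z) (Sigma_pos Z) x0 r
        + angle_integral (lower Z) (Sigma_neg Z) x0 r)"

definition isolating_radius :: "filippov \<Rightarrow> plane \<Rightarrow> real \<Rightarrow> bool" where
  "isolating_radius Z x0 r \<longleftrightarrow>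
     r > 0 \<and> cball x0 r \<subseteq> region Z \<and> (\<forall>x \<in> cball x0 r. singularity Z x \<longleftrightarrow> x = x0)"

(* "The index of Z at x0 is i": the index is defined (x0 is an isolated singularity), and
   every isolating radius yields the value i. *)
definition has_index_at :: "filippov \<Rightarrow> plane \<Rightarrow> real \<Rightarrow> bool" where
  "has_index_at Z x0 i \<longleftrightarrow>
     (\<exists>r. isolating_radius Z x0 r) \<and>
     (\<forall>r. isolating_radius Z x0 r \<longrightarrow> circle_index Z x0 r = i)"

end

theory Submission
  imports Defs
begin

text \<open>Near a singularity on \<open>\<Sigma>\<close> the index only measures how the direction of \<open>F\<^sup>+\<close> turns relative to
that of \<open>F\<^sup>-\<close> along the diameter of the disc that lies on \<open>\<Sigma>\<close>. Indeed, for an isolating radius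
\<open>F\<^sup>+\<close> has no zero on the closed upper half disc, which is convex, so it has a continuous logarithm
there; the integral over the upper arc is therefore minus the change of argument of \<open>F\<^sup>+\<close> along the
diameter, and likewise below. Hence, with \<open>z = F\<^sup>+ / F\<^sup>-\<close> in complex notation, \<open>2 \<pi> I\<close> is the
difference between the two ends of the diameter of (jump term) minus (continuous argument of \<open>z\<close>)
(\<open>circle_index_eq_log_change\<close>). The jump formula is an addition theorem for the arctangent: it gives
the principal argument of \<open>z\<close>, as long as \<open>z\<close> is not a negative number (\<open>jump_eq_Arg\<close>). So \<open>I\<close>
counts the crossings of \<open>z\<close> through the negative real axis, and it vanishes as soon as some rotated
branch of the logarithm is continuous along all of \<open>z\<close> and agrees, up to one common constant, with
the principal branch at both ends (\<open>circle_index_eq_0\<close>).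

If \<open>F\<^sup>+\<close> and \<open>F\<^sup>-\<close> point in opposite directions at a point of \<open>\<Sigma>\<close> and are not both tangent to
\<open>\<Sigma>\<close>, then the sliding field vanishes there (\<open>ratio_not_nonpos\<close>); so within an isolating radius
this can happen at \<open>p\<close> only. At a regular cusp one of the two vectors is tangent to \<open>\<Sigma>\<close> and the
other is transversal, so \<open>z\<close> never meets the negative axis and the principal branch serves. At
a saddle-node \<open>z\<close> is negative at \<open>p\<close> itself, but the imaginary part of \<open>z\<close> is the scalar
sliding field times a factor of constant sign, and this field has a double zero at \<open>p\<close>: \<open>z\<close>
touches the negative axis without crossing it and stays in a closed half plane, on which a
branch rotated by a right angle is continuous.

Isolating radii exist because in both cases a function on \<open>\<Sigma>\<close> has vanishing first and nonvanishing
second derivative at \<open>p\<close>: the Lie derivative \<open>F\<^sup>\<plusminus> f\<close> that vanishes at a cusp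
(\<open>cusp_lie_isolated_zero\<close>), and the sliding field at a saddle-node (\<open>saddle_node_sliding_sign\<close>).\<close>

section \<open>Coordinates on the plane and on the switching line\<close>

abbreviation on_axis :: "real \<Rightarrow> plane" where
  "on_axis s \<equiv> vector [s, 0]"

lemma plane_eqI: "x $ 1 = y $ 1 \<Longrightarrow> x $ 2 = y $ 2 \<Longrightarrow> x = (y :: plane)"
  by (simp add: vec_eq_iff forall_2)

lemma on_axis_eqI: "x $ 2 = 0 \<Longrightarrow> on_axis (x $ 1) = x"
  by (simp add: vec_eq_iff forall_2)

lemma on_axis_eq_scaleR: "on_axis s = s *\<^sub>R axis 1 1"
  by (simp add: vec_eq_iff forall_2 axis_def)

lemma norm_plane: "norm (x :: plane) = sqrt ((x $ 1)\<^sup>2 + (x $ 2)\<^sup>2)"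
  by (simp add: norm_vec_def L2_set_def sum_2)

lemma dist_on_axis: "p $ 2 = 0 \<Longrightarrow> dist p (on_axis s) = \<bar>s - p $ 1\<bar>"
  by (simp add: norm_plane dist_norm)

lemma continuous_on_on_axis [continuous_intros]: "continuous_on S on_axis"
  unfolding on_axis_eq_scaleR[abs_def] by (intro continuous_intros)

lemma eventually_on_axis:
  assumes "eventually P (nhds (p :: plane))" "p $ 2 = 0"
  shows "\<forall>\<^sub>F s in nhds (p $ 1). P (on_axis s)"
proof -
  obtain e where e: "e > 0" "\<And>x. dist x p < e \<Longrightarrow> P x"
    using assms(1) unfolding eventually_nhds_metric by auto
  have "P (on_axis s)" if "dist s (p $ 1) < e" for s
    using that dist_on_axis[OF assms(2), of s] by (intro e(2)) (simp add: dist_commute dist_real_def)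
  then show ?thesis unfolding eventually_nhds_metric using e(1) by blast
qed

text \<open>Complex notation makes angles between plane vectors arguments of quotients.\<close>
definition cplx :: "plane \<Rightarrow> complex" where
  "cplx v = Complex (v $ 1) (v $ 2)"

lemma cplx_sel [simp]: "Re (cplx v) = v $ 1" "Im (cplx v) = v $ 2"
  by (simp_all add: cplx_def)

lemma cplx_eq_0_iff [simp]: "cplx v = 0 \<longleftrightarrow> v = 0"
  by (auto simp: complex_eq_iff vec_eq_iff forall_2)

lemma bounded_linear_cplx: "bounded_linear cplx"
proof -
  have "linear cplx"
    by (rule linearI) (auto simp: complex_eq_iff)
  then show ?thesis by (simp add: linear_conv_bounded_linear)
qed

lemma continuous_on_cplx [continuous_intros]:
  "continuous_on S f \<Longrightarrow> continuous_on S (\<lambda>x. cplx (f x))"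
  by (rule bounded_linear.continuous_on[OF bounded_linear_cplx])

lemma det_cols_eq: "det_cols u v = u $ 1 * v $ 2 - v $ 1 * u $ 2"
  by (simp add: det_cols_def det_2 transpose_def)

lemma Im_cplx_divide: "Im (cplx u / cplx v) = det_cols v u / ((v$1)\<^sup>2 + (v$2)\<^sup>2)"
  by (simp add: Im_divide det_cols_eq algebra_simps)

section \<open>Functions of class \<open>C\<^sup>k\<close>\<close>

abbreviation partial :: "'n::finite \<Rightarrow> (real^'n \<Rightarrow> 'b::real_normed_vector) \<Rightarrow> real^'n \<Rightarrow> 'b" where
  "partial i g x \<equiv> frechet_derivative g (at x) (axis i 1)"

lemma partial_eqI: "(g has_derivative g') (at x) \<Longrightarrow> partial i g x = g' (axis i 1)"
  by (simp add: frechet_derivative_at[symmetric])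

lemma has_derivative_frechet: "g differentiable (at x) \<Longrightarrow> (g has_derivative frechet_derivative g (at x)) (at x)"
  by (simp add: frechet_derivative_works[symmetric])

lemma Ck_on_SucD:
  assumes "Ck_on (Suc k) g D"
  shows "x \<in> D \<Longrightarrow> g differentiable (at x)" "Ck_on k (partial i g) D"
  using assms by auto

text \<open>The closure properties below all compute the partial derivatives of a combination only at
the points of \<open>D\<close>; this lemma lets the computed formula replace them.\<close>
lemma Ck_on_cong:
  assumes "open D" "\<And>x. x \<in> D \<Longrightarrow> g x = h x" "Ck_on k g D"
  shows "Ck_on k h D"
  using assms(2,3)
proof (induction k arbitrary: g h)
  case 0
  then show ?case by (auto cong: continuous_on_cong)
next
  case (Suc k)
  have diff: "(h has_derivative frechet_derivative g (at x)) (at x)" if "x \<in> D" for x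
    using has_derivative_transform_within_open[OF has_derivative_frechet \<open>open D\<close> that] Suc.prems that
    by auto
  have "Ck_on k (partial i h) D" for i
    by (rule Suc.IH[of "partial i g"]) (use Suc.prems(2) partial_eqI[OF diff] in auto)
  with diff show ?case
    by (auto simp: differentiable_def)
qed

lemma Ck_on_Suc_imp: "Ck_on (Suc k) g D \<Longrightarrow> Ck_on k g D"
proof (induction k arbitrary: g)
  case 0
  then show ?case
    by (auto intro!: continuous_at_imp_continuous_on differentiable_imp_continuous_within)
next
  case (Suc k)
  then show ?case by (metis Ck_on.simps(2))
qed

lemma Ck_on_le: "Ck_on k g D \<Longrightarrow> j \<le> k \<Longrightarrow> Ck_on j g D"
proof (induction k)
  case (Suc k)
  then show ?case using Ck_on_Suc_imp le_Suc_eq by blast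
qed simp

lemma Ck_on_imp_continuous_on: "Ck_on k g D \<Longrightarrow> continuous_on D g"
  using Ck_on_le[of k g D 0] by simp

lemma Ck_on_subset: "Ck_on k g D \<Longrightarrow> E \<subseteq> D \<Longrightarrow> Ck_on k g E"
  by (induction k arbitrary: g) (auto intro: continuous_on_subset)

lemma Ck_on_const: "Ck_on k (\<lambda>x. c) D"
  by (induction k arbitrary: c) auto

lemma Ck_on_add:
  assumes "open D" "Ck_on k g D" "Ck_on k h D"
  shows "Ck_on k (\<lambda>x. g x + h x) D"
  using assms(2,3)
proof (induction k arbitrary: g h)
  case (Suc k)
  have d: "((\<lambda>x. g x + h x) has_derivative
      (\<lambda>v. frechet_derivative g (at x) v + frechet_derivative h (at x) v)) (at x)" if "x \<in> D" for x
    using that Suc.prems by (intro has_derivative_add has_derivative_frechet) auto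
  have "Ck_on k (partial i (\<lambda>x. g x + h x)) D" for i
    by (rule Ck_on_cong[OF \<open>open D\<close>, of "\<lambda>x. partial i g x + partial i h x"])
       (use Suc partial_eqI[OF d] in auto)
  with d show ?case by (auto simp: differentiable_def)
qed (auto intro: continuous_intros)

lemma Ck_on_mult:
  fixes g h :: "real^'n \<Rightarrow> real"
  assumes "open D" "Ck_on k g D" "Ck_on k h D"
  shows "Ck_on k (\<lambda>x. g x * h x) D"
  using assms(2,3)
proof (induction k arbitrary: g h)
  case (Suc k)
  have d: "((\<lambda>x. g x * h x) has_derivative
      (\<lambda>v. g x * frechet_derivative h (at x) v + frechet_derivative g (at x) v * h x)) (at x)" 
    if "x \<in> D" for x
    using that Suc.prems by (intro has_derivative_mult has_derivative_frechet) auto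
  have "Ck_on k (partial i (\<lambda>x. g x * h x)) D" for i
  proof (rule Ck_on_cong[OF \<open>open D\<close>])
    show "Ck_on k (\<lambda>x. g x * partial i h x + partial i g x * h x) D"
      using Suc.prems by (intro Ck_on_add[OF \<open>open D\<close>] Suc.IH) (auto intro: Ck_on_Suc_imp)
  qed (use partial_eqI[OF d] in auto)
  with d show ?case by (auto simp: differentiable_def)
qed (auto intro: continuous_intros)

lemma Ck_on_inverse:
  fixes g :: "real^'n \<Rightarrow> real"
  assumes "open D" "Ck_on k g D" "\<And>x. x \<in> D \<Longrightarrow> g x \<noteq> 0"
  shows "Ck_on k (\<lambda>x. inverse (g x)) D"
  using assms(2)
proof (induction k)
  case 0
  then show ?case using assms(3) by (auto intro: continuous_intros)
next
  case (Suc k)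
  have d: "((\<lambda>x. inverse (g x)) has_derivative
      (\<lambda>v. - (inverse (g x) * frechet_derivative g (at x) v * inverse (g x)))) (at x)" 
    if "x \<in> D" for x
    using that Suc.prems assms(3) by (intro Deriv.has_derivative_inverse has_derivative_frechet) auto
  have "Ck_on k (partial i (\<lambda>x. inverse (g x))) D" for i
  proof (rule Ck_on_cong[OF \<open>open D\<close>])
    show "Ck_on k (\<lambda>x. (- 1) * (inverse (g x) * partial i g x * inverse (g x))) D"
      using Suc Ck_on_Suc_imp[OF Suc.prems]
      by (intro Ck_on_mult[OF \<open>open D\<close>] Ck_on_const) auto
  qed (use partial_eqI[OF d] in auto)
  with d show ?case by (auto simp: differentiable_def)
qed

lemma Ck_on_component:
  fixes F :: "real^'n \<Rightarrow> real^'m"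
  assumes "open D" "Ck_on k F D"
  shows "Ck_on k (\<lambda>x. F x $ j) D"
  using assms(2)
proof (induction k arbitrary: F)
  case (Suc k)
  have d: "((\<lambda>x. F x $ j) has_derivative (\<lambda>v. frechet_derivative F (at x) v $ j)) (at x)" 
    if "x \<in> D" for x
    using that Suc.prems
    by (intro bounded_linear.has_derivative[OF bounded_linear_vec_nth] has_derivative_frechet) auto
  have "Ck_on k (partial i (\<lambda>x. F x $ j)) D" for i
    by (rule Ck_on_cong[OF \<open>open D\<close>, of "\<lambda>x. partial i F x $ j"])
       (use Suc partial_eqI[OF d] in auto)
  with d show ?case by (auto simp: differentiable_def)
qed (auto intro: continuous_intros)

lemma Ck_on_2D:
  fixes g :: "plane \<Rightarrow> 'b::real_normed_vector"
  assumes "Ck_on 2 g D" "x \<in> D"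
  shows "g differentiable (at x)" "partial i g differentiable (at x)"
  using assms by (auto simp: numeral_2_eq_2)

lemma lie_eq: "lie F g x = partial 1 g x * F x $ 1 + partial 2 g x * F x $ 2"
  by (simp add: lie_def grad_def inner_vec_def sum_2)

text \<open>One derivative is lost on \<open>g\<close> and none on \<open>F\<close>; hence \<open>C\<^sup>3\<close> data suffice to differentiate
\<open>F f\<close> twice.\<close>
lemma Ck_on_lie:
  assumes "open D" "Ck_on k F D" "Ck_on (Suc k) g D"
  shows "Ck_on k (lie F g) D"
  unfolding lie_eq[abs_def] using assms
  by (intro Ck_on_add Ck_on_mult Ck_on_component) auto

lemma eventually_nonzero:
  fixes g :: "plane \<Rightarrow> 'b::real_normed_vector"
  assumes "continuous_on D g" "open D" "p \<in> D" "g p \<noteq> 0"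
  shows "\<forall>\<^sub>F x in nhds p. g x \<noteq> 0"
proof -
  have "isCont g p" using assms continuous_on_eq_continuous_at by blast
  then have "\<forall>\<^sub>F x in at p. g x \<noteq> 0"
    using assms(4) tendsto_imp_eventually_ne unfolding isCont_def by blast
  then show ?thesis using assms(4) by (simp add: eventually_nhds_conv_at)
qed

lemma has_real_derivative_on_axis:
  fixes g :: "plane \<Rightarrow> real"
  assumes "g differentiable (at (on_axis x))"
  shows "((\<lambda>s. g (on_axis s)) has_real_derivative partial 1 g (on_axis x)) (at x)"
proof -
  let ?g' = "frechet_derivative g (at (on_axis x))"
  have lin: "linear ?g'" using assms by (rule linear_frechet_derivative)
  have 1: "(on_axis has_derivative (\<lambda>s. s *\<^sub>R axis 1 1)) (at x)"
    unfolding on_axis_eq_scaleR[abs_def] by (auto intro!: derivative_eq_intros)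
  have "((\<lambda>s. g (on_axis s)) has_derivative (\<lambda>s. ?g' (s *\<^sub>R axis 1 1))) (at x)"
    using has_derivative_compose[OF 1 has_derivative_frechet[OF assms]] .
  moreover have "(\<lambda>s. ?g' (s *\<^sub>R axis 1 1)) = (*) (?g' (axis 1 1))"
    by (simp add: fun_eq_iff linear_scale[OF lin])
  ultimately show ?thesis by (simp add: has_field_derivative_def)
qed

text \<open>The second derivative test at a zero: \<open>c * g\<close> has derivative \<open>c * g'\<close>, which increases
through \<open>0\<close> at \<open>a\<close> because its own derivative there is \<open>c * c\<close>. Multiplying by \<open>c\<close> covers minima
and maxima at once.\<close>
lemma second_derivative_sign:
  fixes g g' :: "real \<Rightarrow> real"
  assumes d: "\<forall>\<^sub>F s in nhds a. (g has_real_derivative g' s) (at s)"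
    and d2: "(g' has_real_derivative c) (at a)"
    and "g a = 0" "g' a = 0" "c \<noteq> 0"
  shows "\<forall>\<^sub>F s in at a. c * g s > 0"
proof -
  define G where "G s = c * g s" for s
  define G' where "G' s = c * g' s" for s
  obtain e where e: "e > 0" "\<And>s. \<bar>s - a\<bar> < e \<Longrightarrow> (G has_real_derivative G' s) (at s)"
    using d unfolding eventually_nhds_metric G_def[abs_def] G'_def
    by (auto simp: dist_real_def intro!: DERIV_cmult)
  have d2': "(G' has_real_derivative c * c) (at a)"
    unfolding G'_def[abs_def] by (intro DERIV_cmult d2)
  have cc: "c * c > 0" using \<open>c \<noteq> 0\<close> by (simp add: zero_less_mult_iff) linarith
  obtain e1 where e1: "e1 > 0" "\<And>h. h > 0 \<Longrightarrow> h < e1 \<Longrightarrow> G' a < G' (a + h)"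
    using DERIV_pos_inc_right[OF d2' cc] by blast
  obtain e2 where e2: "e2 > 0" "\<And>h. h > 0 \<Longrightarrow> h < e2 \<Longrightarrow> G' (a - h) < G' a"
    using DERIV_pos_inc_left[OF d2' cc] by blast
  have cont: "continuous_on {x..y} G" if "a - e < x" "y < a + e" for x y
  proof (rule DERIV_continuous_on)
    fix z assume "z \<in> {x..y}"
    then have "\<bar>z - a\<bar> < e" using that by (simp add: abs_less_iff)
    then show "(G has_real_derivative G' z) (at z within {x..y})"
      by (rule has_field_derivative_at_within[OF e(2)])
  qed
  have Ga: "G a = 0" "G' a = 0" using assms by (auto simp: G_def G'_def)
  have "G s > 0" if s: "s \<noteq> a" "dist s a < min e (min e1 e2)" for s
  proof (cases "s > a")
    case True
    have "G a < G s"
    proof (rule DERIV_pos_imp_increasing_open[OF True])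
      fix x assume "a < x" "x < s"
      then show "\<exists>y. (G has_real_derivative y) (at x) \<and> y > 0"
        using e(2)[of x] e1(2)[of "x - a"] s Ga by (auto simp: dist_real_def)
    qed (use s e(1) True in \<open>auto intro!: cont simp: dist_real_def\<close>)
    then show ?thesis using Ga by simp
  next
    case False
    then have "s < a" using s by simp
    have "G s > G a"
    proof (rule DERIV_neg_imp_decreasing_open[OF \<open>s < a\<close>])
      fix x assume "s < x" "x < a"
      then show "\<exists>y. (G has_real_derivative y) (at x) \<and> y < 0"
        using e(2)[of x] e2(2)[of "a - x"] s Ga by (auto simp: dist_real_def)
    qed (use s e(1) \<open>s < a\<close> in \<open>auto intro!: cont simp: dist_real_def\<close>)
    then show ?thesis using Ga by simp
  qed
  then show ?thesis
    unfolding eventually_at G_def using e(1) e1(1) e2(1)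
    by (intro exI[of _ "min e (min e1 e2)"]) auto
qed

lemma nonvanishing_same_sign:
  fixes f :: "'a::topological_space \<Rightarrow> real"
  assumes S: "connected S" "continuous_on S f" and nz: "\<And>x. x \<in> S \<Longrightarrow> f x \<noteq> 0" and xy: "x \<in> S" "y \<in> S"
  shows "f x * f y > 0"
proof (rule ccontr)
  assume "\<not> ?thesis"
  then have "min (f x) (f y) \<le> 0" "0 \<le> max (f x) (f y)"
    by (auto simp: not_less mult_le_0_iff)
  moreover have "{min (f x) (f y)..max (f x) (f y)} \<subseteq> f ` S"
    using xy by (intro connected_contains_Icc connected_continuous_image S) (auto simp: min_def max_def)
  ultimately have "0 \<in> f ` S" by auto
  then show False using nz by auto
qed

section \<open>Continuous logarithms along curves\<close>

lemma angle_form_eq_Im: "angle_form w v = Im (cplx v / cplx w)"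
  by (simp add: angle_form_def Im_divide algebra_simps)

text \<open>Near \<open>t\<close> a continuous logarithm \<open>h\<close> differs from the principal logarithm of
\<open>\<gamma> s / \<gamma> t\<close> by the constant \<open>h t\<close>, so it inherits the derivative of \<open>Ln\<close> at \<open>1\<close>.\<close>
lemma has_vector_derivative_log:
  fixes h \<gamma> :: "real \<Rightarrow> complex"
  assumes h: "continuous (at t within S) h" and exp: "\<And>s. s \<in> S \<Longrightarrow> exp (h s) = \<gamma> s"
    and "t \<in> S" and \<gamma>: "(\<gamma> has_vector_derivative d) (at t within S)"
  shows "(h has_vector_derivative d / \<gamma> t) (at t within S)"
proof -
  have [simp]: "\<gamma> t \<noteq> 0" using exp[OF \<open>t \<in> S\<close>] by (metis exp_not_eq_zero)
  obtain e where e: "e > 0" "\<And>s. s \<in> S \<Longrightarrow> dist s t < e \<Longrightarrow> dist (h s) (h t) < pi"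
    using h pi_gt_zero unfolding continuous_within_eps_delta by (metis)
  have "((\<lambda>s. Ln (\<gamma> s / \<gamma> t)) has_vector_derivative (d / \<gamma> t)) (at t within S)"
    using field_vector_diff_chain_within[of "\<lambda>s. \<gamma> s / \<gamma> t" "d / \<gamma> t" t S Ln 1]
      has_vector_derivative_divide[OF \<gamma>, of "\<gamma> t"] 
      has_field_derivative_at_within[OF has_field_derivative_Ln[of 1]]
    by (simp add: o_def)
  then have "((\<lambda>s. h t + Ln (\<gamma> s / \<gamma> t)) has_vector_derivative (d / \<gamma> t)) (at t within S)"
    by (auto intro!: derivative_eq_intros)
  then show ?thesis
  proof (rule has_vector_derivative_transform_within[OF _ e(1) \<open>t \<in> S\<close>])
    fix s assume s: "s \<in> S" "dist s t < e"
    have "\<bar>Im (h s - h t)\<bar> < pi"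
      using abs_Im_le_cmod[of "h s - h t"] e(2)[OF s] by (simp add: dist_norm)
    then have "Ln (exp (h s - h t)) = h s - h t"
      by (intro Ln_exp) auto
    then show "h t + Ln (\<gamma> s / \<gamma> t) = h s"
      using exp[OF s(1)] exp[OF \<open>t \<in> S\<close>] by (simp add: exp_diff)
  qed
qed

text \<open>The angle form is the imaginary part of the logarithmic derivative, so this is the
fundamental theorem of calculus applied to the imaginary part of a logarithm. No continuity of the
derivative is required, since the integral is the gauge integral.\<close>
lemma has_integral_angle_form:
  fixes \<gamma> :: "real \<Rightarrow> plane" and h :: "real \<Rightarrow> complex"
  assumes "\<alpha> \<le> \<beta>" and diff: "\<And>t. t \<in> {\<alpha>..\<beta>} \<Longrightarrow> \<gamma> differentiable (at t)"
    and h: "continuous_on {\<alpha>..\<beta>} h" and exp: "\<And>t. t \<in> {\<alpha>..\<beta>} \<Longrightarrow> exp (h t) = cplx (\<gamma> t)"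
  shows "((\<lambda>t. angle_form (\<gamma> t) (vector_derivative \<gamma> (at t))) has_integral
           Im (h \<beta>) - Im (h \<alpha>)) {\<alpha>..\<beta>}"
proof (rule fundamental_theorem_of_calculus[OF \<open>\<alpha> \<le> \<beta>\<close>])
  fix t assume t: "t \<in> {\<alpha>..\<beta>}"
  have "((\<lambda>s. cplx (\<gamma> s)) has_vector_derivative cplx (vector_derivative \<gamma> (at t))) (at t within {\<alpha>..\<beta>})"
    using diff[OF t] bounded_linear.has_vector_derivative[OF bounded_linear_cplx]
    by (meson has_vector_derivative_at_within vector_derivative_works)
  then have "(h has_vector_derivative cplx (vector_derivative \<gamma> (at t)) / cplx (\<gamma> t)) (at t within {\<alpha>..\<beta>})"
    using h exp t by (intro has_vector_derivative_log) (auto simp: continuous_on_eq_continuous_within)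
  then have "((\<lambda>s. Im (h s)) has_vector_derivative Im (cplx (vector_derivative \<gamma> (at t)) / cplx (\<gamma> t))) (at t within {\<alpha>..\<beta>})"
    by (rule bounded_linear.has_vector_derivative[OF bounded_linear_Im])
  then show "((\<lambda>s. Im (h s)) has_vector_derivative angle_form (\<gamma> t) (vector_derivative \<gamma> (at t)))
    (at t within {\<alpha>..\<beta>})"
    by (simp add: angle_form_eq_Im)
qed

text \<open>Both \<open>Ln (c * w)\<close> and \<open>h\<close> are continuous, and their difference is always a logarithm of \<open>c\<close>;
it takes values in a translate of \<open>2 \<pi> \<i> \<int>\<close> and is therefore constant on the interval.\<close>
lemma log_difference_constant:
  fixes w h :: "real \<Rightarrow> complex"
  assumes w: "continuous_on {x0..x1} w" and h: "continuous_on {x0..x1} h"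
    and exp: "\<And>x. x \<in> {x0..x1} \<Longrightarrow> exp (h x) = w x"
    and c: "\<And>x. x \<in> {x0..x1} \<Longrightarrow> c * w x \<notin> \<real>\<^sub>\<le>\<^sub>0" and "x0 \<le> x1"
  shows "Im (Ln (c * w x1)) - Im (h x1) = Im (Ln (c * w x0)) - Im (h x0)"
proof -
  define D where "D x = Ln (c * w x) - h x" for x
  have expD: "exp (D x) = c" if "x \<in> {x0..x1}" for x
  proof -
    have "c * w x \<noteq> 0" using c[OF that] by auto
    then show ?thesis using exp[OF that] by (simp add: D_def exp_diff)
  qed
  have "D constant_on {x0..x1}"
  proof (rule continuous_discrete_range_constant)
    show "continuous_on {x0..x1} D"
      unfolding D_def using c by (intro continuous_intros w h) auto
    fix x assume x: "x \<in> {x0..x1}"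
    have "2 * pi \<le> norm (D y - D x)" if y: "y \<in> {x0..x1}" "D y \<noteq> D x" for y
    proof (rule ccontr)
      assume "\<not> ?thesis"
      then have "\<bar>Im (D y) - Im (D x)\<bar> < 2 * pi"
        using abs_Im_le_cmod[of "D y - D x"] by simp
      then show False using exp_complex_eqI[of "D y" "D x"] expD x y by simp
    qed
    then show "\<exists>e>0. \<forall>y. y \<in> {x0..x1} \<and> D y \<noteq> D x \<longrightarrow> e \<le> norm (D y - D x)"
      by (intro exI[of _ "2 * pi"]) auto
  qed simp
  then have "D x1 = D x0" using \<open>x0 \<le> x1\<close> unfolding constant_on_def by (metis atLeastAtMost_iff order_refl)
  then show ?thesis unfolding D_def by (metis minus_complex.simps(2))
qed

text \<open>Rotating the upper half plane clockwise, or the lower one counterclockwise, by a right angle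
moves it to the right half plane without passing the branch cut.\<close>
lemma Im_Ln_rotate_half_plane:
  fixes \<sigma> :: real
  assumes "\<sigma> = 1 \<or> \<sigma> = -1" "\<sigma> * Im z > 0"
  shows "Im (Ln (- \<i> * of_real \<sigma> * z)) = Arg z - \<sigma> * (pi / 2)"
proof -
  have z: "z \<noteq> 0" using assms by auto
  have Ln_i: "Ln (- \<i> * of_real \<sigma>) = of_real (- \<sigma> * (pi / 2)) * \<i>"
  proof (cases "\<sigma> = 1")
    case True
    then show ?thesis by (simp add: complex_eq_iff)
  next
    case False
    then have "\<sigma> = -1" using assms by auto
    then show ?thesis by (simp add: complex_eq_iff)
  qed
  have "-pi/2 < Im (Ln z) - \<sigma> * (pi/2) \<and> Im (Ln z) - \<sigma> * (pi/2) < pi/2"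
  proof (cases "\<sigma> = 1")
    case True
    then have "0 < Im (Ln z)" "Im (Ln z) < pi" using assms(2) Im_Ln_pos_lt[OF z] by auto
    then show ?thesis using True by simp
  next
    case False
    then have "\<sigma> = -1" "Im z < 0" using assms by auto
    moreover from this have "Im (Ln z) < 0" "- pi < Im (Ln z)"
      using Im_Ln_pos_le[OF z] mpi_less_Im_Ln[OF z] Im_Ln_le_pi[OF z] by linarith+
    ultimately show ?thesis by simp
  qed
  then have "Ln (- \<i> * of_real \<sigma> * z) = Ln (- \<i> * of_real \<sigma>) + Ln z"
    using z assms(1) by (intro Ln_times_simple) (auto simp: Ln_minus_ii)
  then show ?thesis unfolding Ln_i by (simp add: Arg_eq_Im_Ln[OF z])
qed

text \<open>Put \<open>x = a\<^sup>2 + b\<^sup>2 - a\<close> and \<open>y = 1 - a\<close>. Then \<open>(b + \<i> x) (b + \<i> y)\<close> is the positive number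
\<open>(a - 1)\<^sup>2 + b\<^sup>2\<close> times \<open>a + \<i> b\<close>. After multiplying both factors by the sign of \<open>b\<close> they lie in the
right half plane, where the argument is an arctangent and the arguments add up without reduction.\<close>
lemma Arg_eq_arctan_sum:
  fixes a b :: real
  assumes "b \<noteq> 0"
  shows "Arg (Complex a b) = arctan ((a\<^sup>2 + b\<^sup>2 - a) / b) + arctan ((1 - a) / b)"
proof -
  define x where "x = a\<^sup>2 + b\<^sup>2 - a"
  define y where "y = 1 - a"
  define s where "s = sgn b"
  define N where "N = (a - 1)\<^sup>2 + b\<^sup>2"
  have N: "N > 0" using assms by (simp add: N_def add_nonneg_pos)
  have ss: "s * s = 1" "s * b > 0" using assms by (auto simp: s_def sgn_if)
  have s0: "s \<noteq> 0" using ss by auto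
  let ?u = "Complex (s * b) (s * x)" and ?v = "Complex (s * b) (s * y)"
  have nz: "?u \<noteq> 0" "?v \<noteq> 0" using ss(2) by (auto simp: complex_eq_iff)
  \<comment> \<open>The two signs cancel in the product.\<close>
  have "?u * ?v = of_real (s * s) * (Complex b x * Complex b y)"
    by (simp add: complex_eq_iff algebra_simps)
  also have "Complex b x * Complex b y = of_real N * Complex a b"
    by (simp add: complex_eq_iff x_def y_def N_def algebra_simps power2_eq_square)
  finally have uv: "?u * ?v = of_real N * Complex a b" by (simp add: ss)
  have "Arg ?u = arctan (x / b)" "Arg ?v = arctan (y / b)"
    using arg_conv_arctan[of ?u] arg_conv_arctan[of ?v] ss(2) s0 by auto
  then have im: "Im (Ln ?u) = arctan (x / b)" "Im (Ln ?v) = arctan (y / b)"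
    using nz Arg_eq_Im_Ln by metis+
  have "Ln (?u * ?v) = Ln ?u + Ln ?v"
    using nz arctan_bounded[of "x / b"] arctan_bounded[of "y / b"] im
    by (intro Ln_times_simple) (auto simp: field_simps)
  then have "Arg (?u * ?v) = arctan (x / b) + arctan (y / b)"
    using nz im by (simp add: Arg_eq_Im_Ln)
  moreover have "Arg (?u * ?v) = Arg (Complex a b)" unfolding uv using N by simp
  ultimately show ?thesis by (simp add: x_def y_def)
qed

section \<open>The index as a relative rotation along the switching line\<close>

text \<open>Its argument is the angle from \<open>F\<^sup>-\<close> to \<open>F\<^sup>+\<close>.\<close>
abbreviation ratio :: "filippov \<Rightarrow> plane \<Rightarrow> complex" where
  "ratio Z q \<equiv> cplx (upper Z q) / cplx (lower Z q)"

text \<open>In terms of the quotient \<open>a + \<i> b\<close>, the two quotients \<open>H\<close> are \<open>(a\<^sup>2 + b\<^sup>2 - a) / b\<close> and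
\<open>- (1 - a) / b\<close>, the squared norm of \<open>F\<^sup>-\<close> cancelling; so the jump is the arctangent sum above. If
\<open>b = 0\<close>, the quotient is positive by hypothesis and its argument agrees with the conventional value
\<open>0\<close> of the jump.\<close>
lemma jump_eq_Arg:
  assumes nz: "upper Z q \<noteq> 0" "lower Z q \<noteq> 0"
    and "ratio Z q \<notin> \<real>\<^sub>\<le>\<^sub>0"
  shows "jump Z q = Arg (ratio Z q)"
proof -
  let ?F = "upper Z q" and ?G = "lower Z q"
  define n where "n = (?G $ 1)\<^sup>2 + (?G $ 2)\<^sup>2"
  define a where "a = Re (ratio Z q)"
  define b where "b = Im (ratio Z q)"
  have z: "ratio Z q = Complex a b" by (simp add: a_def b_def)
  have n: "n > 0" unfolding n_def using nz(2)
    by (auto simp: vec_eq_iff forall_2 add_pos_nonneg add_nonneg_pos sum_power2_gt_zero_iff)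
  have a: "?F \<bullet> ?G = n * a" unfolding a_def Re_divide using n
    by (simp add: n_def[symmetric] inner_vec_def sum_2)
  have b: "det_cols ?G ?F = n * b" unfolding b_def Im_cplx_divide using n
    by (simp add: n_def[symmetric])
  have b': "det_cols ?F ?G = - (n * b)" using b by (simp add: det_cols_eq)
  have F: "(norm ?F)\<^sup>2 = n * (a\<^sup>2 + b\<^sup>2)"
  proof -
    have "cplx ?F = ratio Z q * cplx ?G" using nz by simp
    then have eq: "?F $ 1 = a * ?G $ 1 - b * ?G $ 2" "?F $ 2 = a * ?G $ 2 + b * ?G $ 1"
      unfolding z by (auto simp: complex_eq_iff)
    show ?thesis unfolding power2_norm_eq_inner inner_vec_def sum_2 n_def eq
      by (simp add: power2_eq_square algebra_simps)
  qed
  have G: "(norm ?G)\<^sup>2 = n"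
    unfolding power2_norm_eq_inner inner_vec_def sum_2 n_def by (simp add: power2_eq_square)
  show ?thesis
  proof (cases "b = 0")
    case True
    then have "ratio Z q = of_real a" "a > 0"
      using z assms(3) by (auto simp: complex_eq_iff complex_nonpos_Reals_iff)
    then show ?thesis using True b' by (simp add: jump_def)
  next
    case False
    have "H_quot (upper Z) (lower Z) q = (n * (a\<^sup>2 + b\<^sup>2 - a)) / (n * b)"
      by (simp add: H_quot_def F a b algebra_simps)
    then have 1: "H_quot (upper Z) (lower Z) q = (a\<^sup>2 + b\<^sup>2 - a) / b" using n by simp
    have "H_quot (lower Z) (upper Z) q = (n * (1 - a)) / (- (n * b))"
      by (simp add: H_quot_def G a b' inner_commute[of ?G] algebra_simps)
    then have 2: "H_quot (lower Z) (upper Z) q = - ((1 - a) / b)" using n by (simp add: divide_simps)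
    show ?thesis
      unfolding z Arg_eq_arctan_sum[OF False] using False n b'
      by (simp add: jump_def 1 2 arctan_minus)
  qed
qed

lemma Sigma_pos_eq: "planar_filippov l Z \<Longrightarrow> Sigma_pos Z = {x \<in> region Z. x $ 2 \<ge> 0}"
  unfolding planar_filippov_def Sigma_set_def Sigma_pos_def set_eq_iff mem_Collect_eq Int_iff
  by (metis less_le not_le)

lemma Sigma_neg_eq: "planar_filippov l Z \<Longrightarrow> Sigma_neg Z = {x \<in> region Z. x $ 2 \<le> 0}"
  unfolding planar_filippov_def Sigma_set_def Sigma_neg_def set_eq_iff mem_Collect_eq Int_iff
  by (metis less_le not_le)

lemma Sigma_set_eq: "planar_filippov l Z \<Longrightarrow> Sigma_set Z = {x \<in> region Z. x $ 2 = 0}"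
  unfolding planar_filippov_def by auto

lemma circle_at_nth [simp]:
  "circle_at p r t $ 1 = p $ 1 + r * cos t" "circle_at p r t $ 2 = p $ 2 + r * sin t"
  by (simp_all add: circle_at_def)

lemma dist_circle_at: "r \<ge> 0 \<Longrightarrow> dist p (circle_at p r t) = r"
  by (simp add: circle_at_def norm_plane dist_norm power_mult_distrib distrib_left[symmetric])

lemma circle_at_differentiable: "circle_at p r differentiable (at t)"
proof -
  have eq: "circle_at p r = (\<lambda>t. p + r *\<^sub>R (cos t *\<^sub>R axis 1 1 + sin t *\<^sub>R axis 2 1))"
    by (auto intro!: ext plane_eqI simp: axis_def)
  have "(circle_at p r has_vector_derivative (r *\<^sub>R (- sin t *\<^sub>R axis 1 1 + cos t *\<^sub>R axis 2 1))) (at t)"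
    unfolding eq by (auto intro!: derivative_eq_intros simp: algebra_simps)
  then show ?thesis
    by (auto simp: has_vector_derivative_def differentiable_def)
qed

text \<open>A nonvanishing field on a convex set has a continuous logarithm \<open>g\<close> on the whole set, which
turns the integral along an arc in \<open>K\<close> into a difference of boundary values. The same \<open>g\<close> can then
be followed along any other curve in \<open>K\<close> between the end points, here along the diameter.\<close>
lemma angle_integral_convex:
  fixes F :: "plane \<Rightarrow> plane"
  assumes K: "convex K" "continuous_on K F" "\<And>x. x \<in> K \<Longrightarrow> F x \<noteq> 0" and "\<alpha> \<le> \<beta>"
    and circle: "\<And>t. t \<in> {\<alpha>..\<beta>} \<Longrightarrow> circle_at p r t \<in> K"
    and diff: "\<And>t. t \<in> {\<alpha>..\<beta>} \<Longrightarrow> F differentiable (at (circle_at p r t))"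
  obtains g where "continuous_on K g" "\<And>x. x \<in> K \<Longrightarrow> cplx (F x) = exp (g x)"
    "((\<lambda>t. angle_form (F (circle_at p r t)) (vector_derivative (\<lambda>s. F (circle_at p r s)) (at t)))
       has_integral Im (g (circle_at p r \<beta>)) - Im (g (circle_at p r \<alpha>))) {\<alpha>..\<beta>}"
proof -
  obtain g where g: "continuous_on K g" "\<And>x. x \<in> K \<Longrightarrow> cplx (F x) = exp (g x)"
    by (rule continuous_logarithm_on_contractible[of K "\<lambda>x. cplx (F x)"])
       (use K convex_imp_contractible in \<open>auto intro: continuous_intros\<close>)
  have cont: "continuous_on {\<alpha>..\<beta>} (circle_at p r)"
    by (intro continuous_at_imp_continuous_on ballI differentiable_imp_continuous_within
        circle_at_differentiable)
  have "(\<lambda>s. F (circle_at p r s)) differentiable (at t)" if "t \<in> {\<alpha>..\<beta>}" for t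
    using differentiable_chain_at[OF circle_at_differentiable diff[OF that]] by (simp add: o_def)
  then have "((\<lambda>t. angle_form (F (circle_at p r t)) (vector_derivative (\<lambda>s. F (circle_at p r s)) (at t)))
       has_integral Im (g (circle_at p r \<beta>)) - Im (g (circle_at p r \<alpha>))) {\<alpha>..\<beta>}"
    using g circle \<open>\<alpha> \<le> \<beta>\<close>
    by (intro has_integral_angle_form continuous_on_compose2[OF g(1) cont]) auto
  with g show ?thesis by (rule that)
qed

text \<open>Each arc integral is replaced by the change of argument along the diameter. The upper arc runs
from the right to the left end and the lower arc back, so the two changes combine to that of the
quotient \<open>F\<^sup>+ / F\<^sup>-\<close>.\<close>
lemma circle_index_eq_log_change:
  assumes planar: "planar_filippov l Z" "l \<ge> 1"
    and p: "p $ 2 = 0" and r: "r > 0" "cball p r \<subseteq> region Z"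
    and U: "\<And>x. x \<in> cball p r \<Longrightarrow> x $ 2 \<ge> 0 \<Longrightarrow> upper Z x \<noteq> 0"
    and L: "\<And>x. x \<in> cball p r \<Longrightarrow> x $ 2 \<le> 0 \<Longrightarrow> lower Z x \<noteq> 0"
  obtains h where "continuous_on {p $ 1 - r..p $ 1 + r} h"
    "\<And>x. x \<in> {p $ 1 - r..p $ 1 + r} \<Longrightarrow> exp (h x) = ratio Z (on_axis x)"
    "2 * pi * circle_index Z p r = jump Z (on_axis (p $ 1 + r)) - jump Z (on_axis (p $ 1 - r))
       - (Im (h (p $ 1 + r)) - Im (h (p $ 1 - r)))"
proof -
  let ?a = "p $ 1"
  define Ku where "Ku = cball p r \<inter> {x. x $ 2 \<ge> 0}"
  define Kl where "Kl = cball p r \<inter> {x. x $ 2 \<le> 0}"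
  have "convex {x :: plane. axis 2 1 \<bullet> x \<ge> 0}" "convex {x :: plane. axis 2 1 \<bullet> x \<le> 0}"
    by (rule convex_halfspace_ge convex_halfspace_le)+
  then have conv: "convex Ku" "convex Kl"
    unfolding Ku_def Kl_def by (simp_all add: convex_Int inner_axis')
  have Ck: "Ck_on 1 (upper Z) (region Z)" "Ck_on 1 (lower Z) (region Z)"
    by (rule Ck_on_le[OF _ planar(2)], use planar(1) in \<open>simp add: planar_filippov_def\<close>)+
  have sin_le_0: "sin t \<le> 0" if "pi \<le> t" "t \<le> 2 * pi" for t
    using that sin_ge_zero[of "t - pi"] by (simp add: sin_diff)
  have Ck': "Ck_on (Suc 0) (upper Z) (region Z)" "Ck_on (Suc 0) (lower Z) (region Z)"
    using Ck by simp_all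
  have diff: "upper Z differentiable (at x)" "lower Z differentiable (at x)" if "x \<in> cball p r" for x
    using Ck_on_SucD(1)[OF Ck'(1)] Ck_on_SucD(1)[OF Ck'(2)] r(2) that by blast+
  have sub: "Ku \<subseteq> region Z" "Kl \<subseteq> region Z" using r(2) by (auto simp: Ku_def Kl_def)
  have cont: "continuous_on Ku (upper Z)" "continuous_on Kl (lower Z)"
    by (rule continuous_on_subset[OF Ck_on_imp_continuous_on[OF Ck(1)] sub(1)]
        continuous_on_subset[OF Ck_on_imp_continuous_on[OF Ck(2)] sub(2)])+
  have circ: "circle_at p r t \<in> cball p r" for t
    using r(1) dist_circle_at[of r p t] by simp
  have seg: "on_axis x \<in> Ku" "on_axis x \<in> Kl" if "x \<in> {?a - r..?a + r}" for x
    using that dist_on_axis[OF p, of x] by (auto simp: Ku_def Kl_def)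
  have ends: "circle_at p r 0 = on_axis (?a + r)" "circle_at p r pi = on_axis (?a - r)"
    "circle_at p r (2 * pi) = on_axis (?a + r)"
    by (auto intro!: plane_eqI simp: p)
  let ?f = "\<lambda>F t. angle_form (F (circle_at p r t)) (vector_derivative (\<lambda>s. F (circle_at p r s)) (at t))"
  have in_Ku: "circle_at p r t \<in> Ku" if "t \<in> {0..pi}" for t
    using that circ[of t] r(1) by (simp add: Ku_def p sin_ge_zero)
  have in_Kl: "circle_at p r t \<in> Kl" if "t \<in> {pi..2 * pi}" for t
    using that circ[of t] r(1) sin_le_0[of t] by (simp add: Kl_def p mult_le_0_iff)
  have nz: "x \<in> Ku \<Longrightarrow> upper Z x \<noteq> 0" "x \<in> Kl \<Longrightarrow> lower Z x \<noteq> 0" for x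
    using U L unfolding Ku_def Kl_def by blast+
  have pi2: "pi \<le> 2 * pi" by simp
  obtain g1 where g1: "continuous_on Ku g1" "\<And>x. x \<in> Ku \<Longrightarrow> cplx (upper Z x) = exp (g1 x)"
    "(?f (upper Z) has_integral Im (g1 (circle_at p r pi)) - Im (g1 (circle_at p r 0))) {0..pi}"
    by (rule angle_integral_convex[OF conv(1) cont(1) nz(1) pi_ge_zero in_Ku diff(1)[OF circ]]) (assumption | rule that)+
  obtain g2 where g2: "continuous_on Kl g2" "\<And>x. x \<in> Kl \<Longrightarrow> cplx (lower Z x) = exp (g2 x)"
    "(?f (lower Z) has_integral Im (g2 (circle_at p r (2 * pi))) - Im (g2 (circle_at p r pi))) {pi..2 * pi}"
    by (rule angle_integral_convex[OF conv(2) cont(2) nz(2) pi2 in_Kl diff(2)[OF circ]]) (assumption | rule that)+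
  have mem: "circle_at p r t \<in> region Z" for t using circ r(2) by blast
  have pos: "circle_at p r t \<in> Sigma_pos Z \<longleftrightarrow> sin t \<ge> 0" for t
    using r(1) mem[of t] by (simp add: Sigma_pos_eq[OF planar(1)] p zero_le_mult_iff)
  have neg: "circle_at p r t \<in> Sigma_neg Z \<longleftrightarrow> sin t \<le> 0" for t
    using r(1) mem[of t] by (simp add: Sigma_neg_eq[OF planar(1)] p mult_le_0_iff)
  \<comment> \<open>The parameter set is the upper half circle together with the isolated parameter \<open>2 \<pi>\<close>.\<close>
  have "(?f (upper Z) has_integral Im (g1 (circle_at p r pi)) - Im (g1 (circle_at p r 0)))
     {t \<in> {0..2 * pi}. circle_at p r t \<in> Sigma_pos Z}"
  proof (rule iffD1[OF has_integral_spike_set_eq g1(3)])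
    show "negligible {t \<in> {0..pi} - {t \<in> {0..2 * pi}. circle_at p r t \<in> Sigma_pos Z}. ?f (upper Z) t \<noteq> 0}"
      by (rule negligible_subset[of "{}"]) (auto simp: pos sin_ge_zero)
    have "{t \<in> {0..2 * pi}. circle_at p r t \<in> Sigma_pos Z} - {0..pi} \<subseteq> {2 * pi}"
    proof
      fix t assume "t \<in> {t \<in> {0..2 * pi}. circle_at p r t \<in> Sigma_pos Z} - {0..pi}"
      then have "pi < t" "t \<le> 2 * pi" "sin t \<ge> 0" by (auto simp: pos)
      then show "t \<in> {2 * pi}" using sin_lt_zero[of t] by (cases "t = 2 * pi") auto
    qed
    then show "negligible {t \<in> {t \<in> {0..2 * pi}. circle_at p r t \<in> Sigma_pos Z} - {0..pi}. ?f (upper Z) t \<noteq> 0}"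
      by (intro negligible_subset[OF negligible_sing[of "2 * pi"]]) auto
  qed
  then have int1: "angle_integral (upper Z) (Sigma_pos Z) p r = Im (g1 (on_axis (?a - r))) - Im (g1 (on_axis (?a + r)))"
    unfolding angle_integral_def by (subst integral_unique) (auto simp: ends)
  \<comment> \<open>The parameter set is the lower half circle together with the isolated parameter \<open>0\<close>.\<close>
  have "(?f (lower Z) has_integral Im (g2 (circle_at p r (2 * pi))) - Im (g2 (circle_at p r pi)))
     {t \<in> {0..2 * pi}. circle_at p r t \<in> Sigma_neg Z}"
  proof (rule iffD1[OF has_integral_spike_set_eq g2(3)])
    show "negligible {t \<in> {pi..2*pi} - {t \<in> {0..2 * pi}. circle_at p r t \<in> Sigma_neg Z}. ?f (lower Z) t \<noteq> 0}"
      by (rule negligible_subset[of "{}"]) (auto simp: neg sin_le_0)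
    have "{t \<in> {0..2 * pi}. circle_at p r t \<in> Sigma_neg Z} - {pi..2 * pi} \<subseteq> {0}"
    proof
      fix t assume "t \<in> {t \<in> {0..2 * pi}. circle_at p r t \<in> Sigma_neg Z} - {pi..2 * pi}"
      then have "0 \<le> t" "t < pi" "sin t \<le> 0" by (auto simp: neg)
      then show "t \<in> {0}" using sin_gt_zero[of t] by (cases "t = 0") auto
    qed
    then show "negligible {t \<in> {t \<in> {0..2 * pi}. circle_at p r t \<in> Sigma_neg Z} - {pi..2 * pi}. ?f (lower Z) t \<noteq> 0}"
      by (intro negligible_subset[OF negligible_sing[of "0"]]) auto
  qed
  then have int2: "angle_integral (lower Z) (Sigma_neg Z) p r = Im (g2 (on_axis (?a + r))) - Im (g2 (on_axis (?a - r)))"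
    unfolding angle_integral_def by (subst integral_unique) (auto simp: ends)
  have J: "J_right Z p r = jump Z (on_axis (?a + r))" "J_left Z p r = - jump Z (on_axis (?a - r))"
    using r(1) by (auto simp: J_right_def J_left_def p)
  show ?thesis
  proof (rule that[of "\<lambda>x. g1 (on_axis x) - g2 (on_axis x)"])
    show "continuous_on {?a - r..?a + r} (\<lambda>x. g1 (on_axis x) - g2 (on_axis x))"
      by (intro continuous_intros continuous_on_compose2[OF g1(1) continuous_on_on_axis]
          continuous_on_compose2[OF g2(1) continuous_on_on_axis]) (use seg in auto)
    show "exp (g1 (on_axis x) - g2 (on_axis x)) = ratio Z (on_axis x)" if "x \<in> {?a - r..?a + r}" for x
      using g1(2) g2(2) seg[OF that] by (simp add: exp_diff)
    show "2 * pi * circle_index Z p r = jump Z (on_axis (?a + r)) - jump Z (on_axis (?a - r))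
       - (Im (g1 (on_axis (?a + r)) - g2 (on_axis (?a + r))) - Im (g1 (on_axis (?a - r)) - g2 (on_axis (?a - r))))"
      unfolding circle_index_def J int1 int2 by simp
  qed
qed

lemma isolating_radius_nonsingular:
  assumes "isolating_radius Z p r" "x \<in> cball p r" "x \<noteq> p"
  shows "\<not> singularity Z x"
  using assms unfolding isolating_radius_def by blast

text \<open>The number \<open>c\<close> rotates the branch cut out of the way: the hypothesis on \<open>c\<close> makes
\<open>Ln (c * z)\<close> continuous along the diameter, and the hypothesis on the two end points says that this
branch differs from the principal one by the same constant \<open>d\<close> at both, so that the jumps cancel
the continuous change of argument.\<close>
lemma circle_index_eq_0:
  assumes planar: "planar_filippov l Z" "l \<ge> 1"
    and p: "p $ 2 = 0" and iso: "isolating_radius Z p r"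
    and nz: "upper Z p \<noteq> 0" "lower Z p \<noteq> 0"
    and c: "\<And>x. x \<in> {p $ 1 - r..p $ 1 + r} \<Longrightarrow> c * ratio Z (on_axis x) \<notin> \<real>\<^sub>\<le>\<^sub>0"
    and ends: "\<And>x. x \<in> {p $ 1 - r, p $ 1 + r} \<Longrightarrow> ratio Z (on_axis x) \<notin> \<real>\<^sub>\<le>\<^sub>0 \<and>
       Im (Ln (c * ratio Z (on_axis x))) = Arg (ratio Z (on_axis x)) + d"
  shows "circle_index Z p r = 0"
proof -
  have r: "r > 0" "cball p r \<subseteq> region Z" using iso by (auto simp: isolating_radius_def)
  have U: "upper Z x \<noteq> 0" if "x \<in> cball p r" "x $ 2 \<ge> 0" for x
    using isolating_radius_nonsingular[OF iso that(1)] nz that r(2)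
    by (cases "x = p") (auto simp: singularity_def Sigma_pos_eq[OF planar(1)])
  have L: "lower Z x \<noteq> 0" if "x \<in> cball p r" "x $ 2 \<le> 0" for x
    using isolating_radius_nonsingular[OF iso that(1)] nz that r(2)
    by (cases "x = p") (auto simp: singularity_def Sigma_neg_eq[OF planar(1)])
  let ?I = "{p $ 1 - r..p $ 1 + r}"
  obtain h where h: "continuous_on ?I h" "\<And>x. x \<in> ?I \<Longrightarrow> exp (h x) = ratio Z (on_axis x)"
    "2 * pi * circle_index Z p r = jump Z (on_axis (p $ 1 + r)) - jump Z (on_axis (p $ 1 - r))
       - (Im (h (p $ 1 + r)) - Im (h (p $ 1 - r)))"
    using circle_index_eq_log_change[OF planar p r U L] by metis
  have "continuous_on ?I (\<lambda>x. ratio Z (on_axis x))"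
    by (rule continuous_on_eq[OF continuous_on_exp[OF h(1)] h(2)])
  then have eq: "Im (Ln (c * ratio Z (on_axis (p $ 1 + r)))) - Im (h (p $ 1 + r)) =
      Im (Ln (c * ratio Z (on_axis (p $ 1 - r)))) - Im (h (p $ 1 - r))"
    by (rule log_difference_constant[OF _ h(1,2) c]) (use r(1) in auto)
  have "jump Z (on_axis x) = Arg (ratio Z (on_axis x))" if "x \<in> {p $ 1 - r, p $ 1 + r}" for x
    using ends[OF that] U[of "on_axis x"] L[of "on_axis x"] that r(1) dist_on_axis[OF p, of x]
    by (intro jump_eq_Arg) auto
  then have "2 * pi * circle_index Z p r = 0"
    using h(3) eq ends[of "p $ 1 - r"] ends[of "p $ 1 + r"] by simp
  then show ?thesis by simp
qed

section \<open>Lie derivatives and singularities on the switching line\<close>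

lemma planar_filippovD:
  assumes "planar_filippov l Z" "l \<ge> 3"
  shows "open (region Z)" "Ck_on 3 (switch Z) (region Z)" "Ck_on 2 (upper Z) (region Z)"
    "Ck_on 2 (lower Z) (region Z)"
  using assms Ck_on_le[of l _ "region Z" 3] Ck_on_le[of l _ "region Z" 2]
  unfolding planar_filippov_def by auto

text \<open>The first derivative vanishes since \<open>f\<close> is zero along \<open>\<Sigma>\<close>. The second is nonzero by
regularity, and it cannot be negative because \<open>f\<close> is positive just above \<open>\<Sigma>\<close>.\<close>
lemma switch_partials:
  assumes planar: "planar_filippov l Z" "l \<ge> 3" and x: "x \<in> region Z" "x $ 2 = 0"
  shows "partial 1 (switch Z) x = 0" "partial 2 (switch Z) x > 0"
proof -
  let ?f = "switch Z"
  note D = planar_filippovD[OF planar]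
  have f0: "?f y = 0" if "y \<in> region Z" "y $ 2 = 0" for y
    using Sigma_set_eq[OF planar(1)] that unfolding Sigma_set_def by blast
  have diff: "?f differentiable (at x)" using D(2) x by (auto simp: numeral_3_eq_3)
  have ev: "\<forall>\<^sub>F s in nhds (x $ 1). on_axis s \<in> region Z"
    by (rule eventually_on_axis) (use D(1) x in \<open>auto simp: eventually_nhds\<close>)
  have "((\<lambda>s. ?f (on_axis s)) has_real_derivative partial 1 ?f x) (at (x $ 1))"
    using has_real_derivative_on_axis[of ?f "x $ 1"] diff x by (simp add: on_axis_eqI)
  moreover have "((\<lambda>s. ?f (on_axis s)) has_real_derivative 0) (at (x $ 1))"
    by (subst DERIV_cong_ev[OF refl _ refl, where g = "\<lambda>s. 0"])
       (use ev in \<open>auto elim!: eventually_mono simp: f0\<close>)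
  ultimately show 1: "partial 1 ?f x = 0" by (rule DERIV_unique)
  have "grad ?f x \<noteq> 0"
    using planar(1) x f0[OF x] unfolding planar_filippov_def by blast
  then have ne: "partial 2 ?f x \<noteq> 0"
    using 1 by (auto simp: grad_def vec_eq_iff forall_2)
  have lin: "linear (frechet_derivative ?f (at x))" using diff by (rule linear_frechet_derivative)
  have "((\<lambda>t. x + t *\<^sub>R axis 2 1) has_derivative (\<lambda>t. t *\<^sub>R axis 2 1)) (at 0)"
    by (auto intro!: derivative_eq_intros)
  moreover have "(?f has_derivative frechet_derivative ?f (at x)) (at (x + 0 *\<^sub>R axis 2 1))"
    using has_derivative_frechet[OF diff] by simp
  ultimately have "((\<lambda>t. ?f (x + t *\<^sub>R axis 2 1)) has_derivative
      (\<lambda>t. frechet_derivative ?f (at x) (t *\<^sub>R axis 2 1))) (at 0)"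
    by (rule has_derivative_compose)
  moreover have "(\<lambda>t. frechet_derivative ?f (at x) (t *\<^sub>R axis 2 1)) = (*) (partial 2 ?f x)"
    by (simp add: fun_eq_iff linear_scale[OF lin])
  ultimately have der: "((\<lambda>t. ?f (x + t *\<^sub>R axis 2 1)) has_real_derivative partial 2 ?f x) (at 0)"
    by (simp add: has_field_derivative_def)
  have "\<not> partial 2 ?f x < 0"
  proof
    assume "partial 2 ?f x < 0"
    then obtain d where d: "d > 0" "\<And>h. h > 0 \<Longrightarrow> h < d \<Longrightarrow> ?f (x + h *\<^sub>R axis 2 1) < ?f x"
      using DERIV_neg_dec_right[OF der] by auto
    obtain e where e: "e > 0" "ball x e \<subseteq> region Z"
      using D(1) x(1) open_contains_ball by blast
    define h where "h = min d e / 2"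
    have h: "h > 0" "h < d" "h < e" using d(1) e(1) by (auto simp: h_def)
    have "x + h *\<^sub>R axis 2 1 \<in> region Z"
      using h e(2) by (auto simp: subset_iff dist_norm norm_axis_1)
    moreover have "(x + h *\<^sub>R axis 2 1) $ 2 > 0" using h(1) x(2) by (simp add: axis_def)
    ultimately have "?f (x + h *\<^sub>R axis 2 1) > 0"
      using planar(1) unfolding planar_filippov_def by blast
    then show False using d(2)[OF h(1,2)] f0[OF x] by simp
  qed
  then show "partial 2 ?f x > 0" using ne by simp
qed

text \<open>So on \<open>\<Sigma>\<close> the Lie derivative is the vertical component of the field up to a positive factor.\<close>
lemma lie_switch_eq:
  assumes "planar_filippov l Z" "l \<ge> 3" "x \<in> region Z" "x $ 2 = 0"
  shows "lie F (switch Z) x = partial 2 (switch Z) x * F x $ 2"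
  using switch_partials[OF assms] by (simp add: lie_eq)

lemma sliding_field_snd:
  assumes "planar_filippov l Z" "l \<ge> 3" "x \<in> region Z" "x $ 2 = 0"
  shows "sliding_field Z x $ 2 = 0"
  by (simp add: sliding_field_def lie_switch_eq[OF assms])

text \<open>If \<open>F\<^sup>+ = - k F\<^sup>-\<close> with \<open>k > 0\<close>, then \<open>F\<^sup>+ f = - k F\<^sup>- f\<close>; as one of these Lie derivatives
is nonzero, both are, and they have opposite signs, so the point slides or escapes, and substituting into the definition of the
sliding field gives \<open>0\<close>.\<close>
lemma ratio_not_nonpos:
  assumes x: "x \<in> Sigma_set Z" and nz: "upper Z x \<noteq> 0" "lower Z x \<noteq> 0"
    and lie: "lie (upper Z) (switch Z) x \<noteq> 0 \<or> lie (lower Z) (switch Z) x \<noteq> 0"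
    and sl: "x \<in> sliding_set Z \<union> escaping_set Z \<Longrightarrow> sliding_field Z x \<noteq> 0"
  shows "ratio Z x \<notin> \<real>\<^sub>\<le>\<^sub>0"
proof
  assume "ratio Z x \<in> \<real>\<^sub>\<le>\<^sub>0"
  then obtain k where k: "k \<ge> 0" "ratio Z x = - of_real k"
    by (metis nonpos_Reals_cases neg_0_le_iff_le of_real_minus minus_minus)
  have "cplx (upper Z x) = ratio Z x * cplx (lower Z x)" using nz by simp
  then have F: "upper Z x = (- k) *\<^sub>R lower Z x"
    unfolding k by (intro plane_eqI) (auto simp: complex_eq_iff)
  have k0: "k > 0" using F nz k(1) by (cases "k = 0") auto
  have l: "lie (upper Z) (switch Z) x = - k * lie (lower Z) (switch Z) x"
    unfolding lie_def F by simp
  then have l0: "lie (lower Z) (switch Z) x \<noteq> 0" using lie k0 by auto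
  then have "x \<in> sliding_set Z \<union> escaping_set Z"
    using x k0 l by (auto simp: sliding_set_def escaping_set_def zero_less_mult_iff mult_less_0_iff not_less)
  moreover have "sliding_field Z x = 0"
    unfolding sliding_field_def l F by simp
  ultimately show False using sl by blast
qed

lemma nonsingular_on_axis:
  assumes "x \<in> Sigma_set Z" "\<not> singularity Z x"
  shows "upper Z x \<noteq> 0" "lower Z x \<noteq> 0" "lie (upper Z) (switch Z) x \<noteq> 0"
    "lie (lower Z) (switch Z) x \<noteq> 0" 
    "x \<in> sliding_set Z \<union> escaping_set Z \<Longrightarrow> sliding_field Z x \<noteq> 0"
  using assms by (auto simp: singularity_def Sigma_set_def Sigma_pos_def Sigma_neg_def)

text \<open>Off \<open>\<Sigma>\<close> only zeros of \<open>F\<^sup>\<plusminus>\<close> are singularities, and these stay away from \<open>p\<close> by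
continuity; so isolation has to be checked along \<open>\<Sigma>\<close> only.\<close>
lemma isolating_radius_exists:
  assumes planar: "planar_filippov l Z" "l \<ge> 3" and p: "p \<in> Sigma_set Z"
    and sing: "singularity Z p" and nz: "upper Z p \<noteq> 0" "lower Z p \<noteq> 0"
    and ev: "\<forall>\<^sub>F s in at (p $ 1). \<not> singularity Z (on_axis s)"
  shows "\<exists>r. isolating_radius Z p r"
proof -
  note D = planar_filippovD[OF planar]
  have pD: "p \<in> region Z" "p $ 2 = 0" using p Sigma_set_eq[OF planar(1)] by auto
  have "\<forall>\<^sub>F x in nhds p. x \<in> region Z \<and> upper Z x \<noteq> 0 \<and> lower Z x \<noteq> 0"
    using eventually_nonzero[OF Ck_on_imp_continuous_on[OF D(3)] D(1) pD(1) nz(1)]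
      eventually_nonzero[OF Ck_on_imp_continuous_on[OF D(4)] D(1) pD(1) nz(2)]
      eventually_nhds_in_open[OF D(1) pD(1)]
    by eventually_elim auto
  then obtain e where e: "e > 0" "\<And>x. dist x p < e \<Longrightarrow> x \<in> region Z \<and> upper Z x \<noteq> 0 \<and> lower Z x \<noteq> 0"
    unfolding eventually_nhds_metric by auto
  obtain d where d: "d > 0" "\<And>s. s \<noteq> p $ 1 \<Longrightarrow> dist s (p $ 1) < d \<Longrightarrow> \<not> singularity Z (on_axis s)"
    using ev unfolding eventually_at by auto
  \<comment> \<open>Halving makes the inequalities strict on the closed ball.\<close>
  define r where "r = min d e / 2"
  have r: "r > 0" "r < d" "r < e" using d e by (auto simp: r_def)
  have "\<not> singularity Z x" if x: "x \<in> cball p r" "x \<noteq> p" for x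
  proof (cases "x $ 2 = 0")
    case True
    then have "x $ 1 \<noteq> p $ 1" using x(2) pD(2) plane_eqI[of x p] by auto
    moreover have "dist (x $ 1) (p $ 1) < d"
      using x(1) r dist_on_axis[OF pD(2), of "x $ 1"] True by (simp add: on_axis_eqI dist_real_def)
    ultimately show ?thesis using d(2)[of "x $ 1"] True by (simp add: on_axis_eqI)
  next
    case False
    then have "x \<notin> Sigma_set Z" using Sigma_set_eq[OF planar(1)] by auto
    moreover have "upper Z x \<noteq> 0" "lower Z x \<noteq> 0" using x r e(2)[of x] by (auto simp: dist_commute)
    ultimately show ?thesis by (auto simp: singularity_def sliding_set_def escaping_set_def)
  qed
  moreover have "cball p r \<subseteq> region Z" using e(2) r by (force simp: dist_commute)
  ultimately have "isolating_radius Z p r" using r(1) sing unfolding isolating_radius_def by blast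
  then show ?thesis ..
qed

section \<open>Regular-cusp tangential singularities\<close>

text \<open>Write \<open>G = F f\<close> and \<open>p = (a, 0)\<close>. On \<open>\<Sigma>\<close> one has \<open>G = f\<^sub>y F\<^sub>2\<close>, so \<open>F\<^sub>2\<close> vanishes at \<open>p\<close> and
\<open>F\<^sup>2 f = G\<^sub>x F\<^sub>1 + G\<^sub>y F\<^sub>2\<close> gives \<open>G\<^sub>x = 0\<close> at \<open>p\<close>, whence also \<open>\<partial>\<^sub>x F\<^sub>2 = 0\<close>. Differentiating once more,
\<open>F\<^sup>3 f = G\<^sub>x\<^sub>x F\<^sub>1\<^sup>2\<close> at \<open>p\<close>, all other terms containing one of the vanishing factors. Thus \<open>G\<close> has a
nondegenerate critical zero along \<open>\<Sigma>\<close>.\<close>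
lemma cusp_lie_isolated_zero:
  assumes planar: "planar_filippov l Z" "l \<ge> 3" and p: "p \<in> region Z" "p $ 2 = 0"
    and F: "Ck_on 2 F (region Z)"
    and cusp: "lie F (switch Z) p = 0" "(lie F ^^ 2) (switch Z) p = 0" "(lie F ^^ 3) (switch Z) p \<noteq> 0"
  shows "\<forall>\<^sub>F s in at (p $ 1). lie F (switch Z) (on_axis s) \<noteq> 0"
proof -
  let ?f = "switch Z" and ?D = "region Z" and ?a = "p $ 1"
  note D = planar_filippovD[OF planar]
  define G where "G = lie F ?f"
  define m where "m = partial 2 ?f"
  have axp: "on_axis ?a = p" using p(2) by (rule on_axis_eqI)
  have CkG: "Ck_on 2 G ?D" unfolding G_def
    using D(2) by (intro Ck_on_lie[OF D(1) F]) (simp add: numeral_3_eq_3 numeral_2_eq_2)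
  have Ckm: "Ck_on 2 m ?D" unfolding m_def
    using D(2) by (simp add: numeral_3_eq_3 numeral_2_eq_2)
  have ev: "\<forall>\<^sub>F s in nhds ?a. on_axis s \<in> ?D"
    by (rule eventually_on_axis[OF eventually_nhds_in_open[OF D(1) p(1)] p(2)])
  have G_eq: "G x = m x * F x $ 2" if "x \<in> ?D" "x $ 2 = 0" for x
    unfolding G_def m_def by (rule lie_switch_eq[OF planar that])
  have m0: "m p \<noteq> 0" using switch_partials(2)[OF planar p] by (simp add: m_def)
  have F2: "F p $ 2 = 0" using G_eq[OF p] cusp(1) m0 by (simp add: G_def)
  have lie2: "lie F G x = partial 1 G x * F x $ 1 + partial 2 G x * F x $ 2" for x
    by (rule lie_eq)
  have lie3: "(lie F ^^ 3) ?f p = partial 1 (lie F G) p * F p $ 1"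
    by (simp add: numeral_3_eq_3 G_def[symmetric] lie_eq[of F "lie F G"] F2)
  then have F1: "F p $ 1 \<noteq> 0" using cusp(3) by auto
  have "(lie F ^^ 2) ?f p = partial 1 G p * F p $ 1"
    by (simp add: numeral_2_eq_2 G_def[symmetric] lie2 F2)
  then have dG0: "partial 1 G p = 0" using cusp(2) F1 by simp
  have der: "((\<lambda>s. g (on_axis s)) has_real_derivative partial 1 g p) (at ?a)"
    if "g differentiable (at p)" for g :: "plane \<Rightarrow> real"
    using has_real_derivative_on_axis[of g ?a] that by (simp add: axp)
  have CkF: "Ck_on 2 (\<lambda>x. F x $ i) ?D" for i by (rule Ck_on_component[OF D(1) F])
  \<comment> \<open>Compute the derivative of \<open>G = m F\<^sub>2\<close> along \<open>\<Sigma>\<close> in two ways, to find that of \<open>F\<^sub>2\<close>.\<close>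
  have "((\<lambda>s. m (on_axis s) * F (on_axis s) $ 2) has_real_derivative
      m p * partial 1 (\<lambda>x. F x $ 2) p) (at ?a)"
    using DERIV_mult[OF der[OF Ck_on_2D(1)[OF Ckm p(1)]] der[OF Ck_on_2D(1)[OF CkF[of 2] p(1)]]]
    by (simp add: axp F2 mult.commute)
  moreover have "((\<lambda>s. m (on_axis s) * F (on_axis s) $ 2) has_real_derivative 0) (at ?a)"
    using der[OF Ck_on_2D(1)[OF CkG p(1)]] unfolding dG0
    by (rule iffD1[OF DERIV_cong_ev[OF refl _ refl], rotated])
       (use ev in \<open>auto elim!: eventually_mono simp: G_eq\<close>)
  ultimately have dF2: "partial 1 (\<lambda>x. F x $ 2) p = 0"
    using m0 DERIV_unique by fastforce
  define c where "c = partial 1 (partial 1 G) p"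
  have "((\<lambda>s. lie F G (on_axis s)) has_real_derivative c * F p $ 1) (at ?a)"
    unfolding lie2
    using DERIV_add[OF DERIV_mult[OF der[OF Ck_on_2D(2)[OF CkG p(1), of 1]] der[OF Ck_on_2D(1)[OF CkF[of 1] p(1)]]]
        DERIV_mult[OF der[OF Ck_on_2D(2)[OF CkG p(1), of 2]] der[OF Ck_on_2D(1)[OF CkF[of 2] p(1)]]]]
    by (simp add: axp F2 dF2 dG0 c_def)
  moreover have "Ck_on 1 (lie F G) ?D"
    using CkG Ck_on_le[OF F, of 1] by (intro Ck_on_lie[OF D(1)]) (simp_all add: numeral_2_eq_2)
  then have "lie F G differentiable (at p)" using p(1) by auto
  ultimately have "partial 1 (lie F G) p = c * F p $ 1"
    using der DERIV_unique by blast
  then have "c \<noteq> 0" using lie3 cusp(3) by auto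
  have "\<forall>\<^sub>F s in at ?a. c * G (on_axis s) > 0"
  proof (rule second_derivative_sign)
    show "\<forall>\<^sub>F s in nhds ?a. ((\<lambda>s. G (on_axis s)) has_real_derivative partial 1 G (on_axis s)) (at s)"
      using ev by eventually_elim (intro has_real_derivative_on_axis Ck_on_2D[OF CkG])
    show "((\<lambda>s. partial 1 G (on_axis s)) has_real_derivative c) (at ?a)"
      unfolding c_def by (intro der Ck_on_2D[OF CkG] p)
  qed (use \<open>c \<noteq> 0\<close> dG0 cusp(1) in \<open>simp_all add: axp G_def\<close>)
  then show ?thesis by eventually_elim (auto simp: G_def)
qed

lemma regular_cusp_nonzero:
  assumes "regular_cusp Z p"
  shows "upper Z p \<noteq> 0" "lower Z p \<noteq> 0"
proof -
  have "lie F g p = 0" if "F p = 0" for F g using that by (simp add: lie_def)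
  moreover have "(lie F ^^ 3) g p = lie F ((lie F ^^ 2) g) p" for F g
    by (simp add: numeral_3_eq_3 numeral_2_eq_2)
  ultimately show "upper Z p \<noteq> 0" "lower Z p \<noteq> 0"
    using assms unfolding regular_cusp_def cusp_regular_pair_def by metis+
qed

text \<open>At \<open>p\<close> exactly one of the two Lie derivatives vanishes. Hence the numerator of the sliding field is
a nonzero multiple of a nonzero vector there, and nearby no sliding point is a pseudo-equilibrium.
One Lie derivative is nonzero near \<open>p\<close> by continuity, the other one off \<open>p\<close> by \<open>cusp_lie_isolated_zero\<close>.\<close>
lemma regular_cusp_isolating_radius:
  assumes planar: "planar_filippov l Z" "l \<ge> 3" and cusp: "regular_cusp Z p"
  shows "\<exists>r. isolating_radius Z p r"
proof -
  let ?U = "lie (upper Z) (switch Z)" and ?L = "lie (lower Z) (switch Z)"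
  note D = planar_filippovD[OF planar]
  have p: "p \<in> Sigma_set Z" using cusp by (simp add: regular_cusp_def)
  then have pD: "p \<in> region Z" "p $ 2 = 0" using Sigma_set_eq[OF planar(1)] by auto
  have "Ck_on 2 ?U (region Z)" "Ck_on 2 ?L (region Z)"
    using D(2) by (intro Ck_on_lie D; simp add: numeral_3_eq_3 numeral_2_eq_2)+
  then have contl: "continuous_on (region Z) ?U" "continuous_on (region Z) ?L"
    by (auto intro: Ck_on_imp_continuous_on)
  have contF: "continuous_on (region Z) (upper Z)" "continuous_on (region Z) (lower Z)"
    using D by (auto intro: Ck_on_imp_continuous_on)
  note nz = regular_cusp_nonzero[OF cusp]
  define N where "N x = ?L x *\<^sub>R upper Z x - ?U x *\<^sub>R lower Z x" for x
  have contN: "continuous_on (region Z) N"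
    unfolding N_def[abs_def] by (intro continuous_intros contl contF)
  have "N p \<noteq> 0"
    using cusp nz unfolding regular_cusp_def cusp_regular_pair_def N_def by auto
  then have evN: "\<forall>\<^sub>F s in nhds (p $ 1). N (on_axis s) \<noteq> 0"
    by (intro eventually_on_axis eventually_nonzero[OF contN D(1)] pD)
  have ev_lie: "\<forall>\<^sub>F s in at (p $ 1). lie F (switch Z) (on_axis s) \<noteq> 0"
    if "lie F (switch Z) p \<noteq> 0" "continuous_on (region Z) (lie F (switch Z))" for F
    using eventually_on_axis[OF eventually_nonzero[OF that(2) D(1) pD(1) that(1)] pD(2)]
    by (simp add: eventually_nhds_conv_at)
  have evU: "\<forall>\<^sub>F s in at (p $ 1). ?U (on_axis s) \<noteq> 0"
    using cusp ev_lie[OF _ contl(1)] cusp_lie_isolated_zero[OF planar pD D(3)]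
    unfolding regular_cusp_def cusp_regular_pair_def by blast
  have evL: "\<forall>\<^sub>F s in at (p $ 1). ?L (on_axis s) \<noteq> 0"
    using cusp ev_lie[OF _ contl(2)] cusp_lie_isolated_zero[OF planar pD D(4)]
    unfolding regular_cusp_def cusp_regular_pair_def by blast
  have evN': "\<forall>\<^sub>F s in at (p $ 1). N (on_axis s) \<noteq> 0"
    using evN by (simp add: eventually_nhds_conv_at)
  show ?thesis
  proof (rule isolating_radius_exists[OF planar p _ nz])
    show "singularity Z p"
      using cusp p unfolding regular_cusp_def cusp_regular_pair_def singularity_def by blast
    show "\<forall>\<^sub>F s in at (p $ 1). \<not> singularity Z (on_axis s)"
      using evU evL evN'
    proof eventually_elim
      case (elim s)
      have "upper Z (on_axis s) \<noteq> 0" "lower Z (on_axis s) \<noteq> 0"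
        using elim by (auto simp: lie_def)
      moreover have "sliding_field Z (on_axis s) \<noteq> 0" if "on_axis s \<in> sliding_set Z \<union> escaping_set Z"
        using that elim(3) by (auto simp: sliding_field_def N_def sliding_set_def escaping_set_def)
      ultimately show ?case using elim by (auto simp: singularity_def)
    qed
  qed
qed

text \<open>The two fields are nowhere opposite along the diameter, so the principal branch itself is
continuous: \<open>c = 1\<close>.\<close>
lemma regular_cusp_index:
  assumes planar: "planar_filippov l Z" "l \<ge> 3" and cusp: "regular_cusp Z p"
    and r: "isolating_radius Z p r"
  shows "circle_index Z p r = 0"
proof -
  have p: "p \<in> Sigma_set Z" using cusp by (simp add: regular_cusp_def)
  then have pD: "p \<in> region Z" "p $ 2 = 0" using Sigma_set_eq[OF planar(1)] by auto
  have r': "r > 0" "cball p r \<subseteq> region Z" using r by (auto simp: isolating_radius_def)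
  note nz = regular_cusp_nonzero[OF cusp]
  have ratio: "ratio Z (on_axis x) \<notin> \<real>\<^sub>\<le>\<^sub>0" if "x \<in> {p $ 1 - r..p $ 1 + r}" for x
  proof (cases "on_axis x = p")
    case True
    have "p \<notin> sliding_set Z \<union> escaping_set Z"
      "lie (upper Z) (switch Z) p \<noteq> 0 \<or> lie (lower Z) (switch Z) p \<noteq> 0"
      using cusp unfolding regular_cusp_def cusp_regular_pair_def sliding_set_def escaping_set_def by auto
    then show ?thesis unfolding True by (intro ratio_not_nonpos p nz) auto
  next
    case False
    have mem: "on_axis x \<in> cball p r" using that dist_on_axis[OF pD(2), of x] by auto
    then have S: "on_axis x \<in> Sigma_set Z" using r'(2) Sigma_set_eq[OF planar(1)] by auto
    note ns = nonsingular_on_axis[OF S isolating_radius_nonsingular[OF r mem False]]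
    show ?thesis using ns by (intro ratio_not_nonpos S) auto
  qed
  show ?thesis
  proof (rule circle_index_eq_0[OF planar(1) _ pD(2) r nz, where c = 1 and d = 0])
    show "l \<ge> 1" using planar by simp
    fix x assume x: "x \<in> {p $ 1 - r, p $ 1 + r}"
    then have "ratio Z (on_axis x) \<notin> \<real>\<^sub>\<le>\<^sub>0" using r'(1) by (intro ratio) auto
    moreover from this have "ratio Z (on_axis x) \<noteq> 0" by (metis nonpos_Reals_zero_I)
    ultimately show "ratio Z (on_axis x) \<notin> \<real>\<^sub>\<le>\<^sub>0 \<and>
        Im (Ln (1 * ratio Z (on_axis x))) = Arg (ratio Z (on_axis x)) + 0"
      by (simp add: Arg_eq_Im_Ln)
  qed (use ratio in simp)
qed

section \<open>Saddle-node pseudo-equilibria\<close>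

text \<open>The formula for the sliding field makes sense and is \<open>C\<^sup>2\<close> on the open set where its denominator
does not vanish, which contains \<open>p\<close>; so \<open>deriv\<close> computes genuine derivatives and the second
derivative test applies.\<close>
lemma saddle_node_sliding_sign:
  assumes planar: "planar_filippov l Z" "l \<ge> 3" and sn: "saddle_node_pseudo_equilibrium Z p"
  obtains c where "c \<noteq> 0" "\<forall>\<^sub>F s in at (p $ 1). c * sliding_scalar Z s > 0"
proof -
  let ?U = "lie (upper Z) (switch Z)" and ?L = "lie (lower Z) (switch Z)" and ?a = "p $ 1"
  let ?g = "sliding_scalar Z"
  note D = planar_filippovD[OF planar]
  have se: "p \<in> sliding_set Z \<union> escaping_set Z"
    using sn by (simp add: saddle_node_pseudo_equilibrium_def)
  then have p: "p \<in> Sigma_set Z" by (auto simp: sliding_set_def escaping_set_def)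
  then have pD: "p \<in> region Z" "p $ 2 = 0" using Sigma_set_eq[OF planar(1)] by auto
  have CkU: "Ck_on 2 ?U (region Z)" and CkL: "Ck_on 2 ?L (region Z)"
    using D(2) by (intro Ck_on_lie D; simp add: numeral_3_eq_3 numeral_2_eq_2)+
  \<comment> \<open>Differences are written with the factor \<open>- 1\<close> to match the closure rules for sums and products.\<close>
  define W where "W x = ?L x + (- 1) * ?U x" for x
  have CkW: "Ck_on 2 W (region Z)" unfolding W_def[abs_def]
    by (intro Ck_on_add Ck_on_mult Ck_on_const CkU CkL D)
  define E where "E = {x \<in> region Z. W x \<noteq> 0}"
  have "E = region Z \<inter> W -` (- {0})" unfolding E_def by auto
  then have E: "open E" "E \<subseteq> region Z"
    using continuous_open_preimage[OF Ck_on_imp_continuous_on[OF CkW] D(1), of "- {0}"] by auto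
  define S where "S x = (?L x * upper Z x $ 1 + (- 1) * (?U x * lower Z x $ 1)) * inverse (W x)" for x
  have CkS: "Ck_on 2 S E" unfolding S_def[abs_def]
    by (intro Ck_on_mult Ck_on_add Ck_on_const Ck_on_inverse Ck_on_component E
        Ck_on_subset[OF CkU E(2)] Ck_on_subset[OF CkL E(2)] Ck_on_subset[OF CkW E(2)]
        Ck_on_subset[OF D(3) E(2)] Ck_on_subset[OF D(4) E(2)]) (auto simp: E_def)
  have g: "?g = (\<lambda>s. S (on_axis s))"
    by (auto simp: fun_eq_iff sliding_scalar_def sliding_field_def S_def W_def mult.commute)
  have pE: "p \<in> E" using se pD by (auto simp: E_def W_def sliding_set_def escaping_set_def)
  have axp: "on_axis ?a = p" using pD(2) by (rule on_axis_eqI)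
  have "\<forall>\<^sub>F s in nhds ?a. on_axis s \<in> E"
    by (rule eventually_on_axis[OF eventually_nhds_in_open[OF E(1) pE] pD(2)])
  then have d1: "\<forall>\<^sub>F s in nhds ?a. (?g has_real_derivative partial 1 S (on_axis s)) (at s)"
    unfolding g by eventually_elim (intro has_real_derivative_on_axis Ck_on_2D[OF CkS])
  then have d1': "\<forall>\<^sub>F s in nhds ?a. deriv ?g s = partial 1 S (on_axis s)"
    by eventually_elim (rule DERIV_imp_deriv)
  have d2: "((\<lambda>s. partial 1 S (on_axis s)) has_real_derivative partial 1 (partial 1 S) p) (at ?a)"
    using has_real_derivative_on_axis[of "partial 1 S" ?a] Ck_on_2D(2)[OF CkS pE] by (simp add: axp)
  have "(deriv ?g has_real_derivative partial 1 (partial 1 S) p) (at ?a)"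
    using d2 by (subst DERIV_cong_ev[OF refl d1' refl])
  then have "deriv (deriv ?g) ?a = partial 1 (partial 1 S) p" by (rule DERIV_imp_deriv)
  then have c0: "partial 1 (partial 1 S) p \<noteq> 0"
    using sn by (simp add: saddle_node_pseudo_equilibrium_def)
  show ?thesis
  proof (rule that[OF c0 second_derivative_sign[OF d1 d2 _ _ c0]])
    show "?g ?a = 0" using sn by (simp add: saddle_node_pseudo_equilibrium_def)
    show "partial 1 S (on_axis ?a) = 0"
      using eventually_nhds_x_imp_x[OF d1'] sn by (simp add: saddle_node_pseudo_equilibrium_def)
  qed
qed

text \<open>The Lie derivatives are nonzero at \<open>p\<close>, hence near \<open>p\<close>, and so are the fields; the remaining
condition is that \<open>p\<close> is an isolated zero of the sliding field.\<close>
lemma saddle_node_isolating_radius: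
  assumes planar: "planar_filippov l Z" "l \<ge> 3" and sn: "saddle_node_pseudo_equilibrium Z p"
  shows "\<exists>r. isolating_radius Z p r"
proof -
  let ?U = "lie (upper Z) (switch Z)" and ?L = "lie (lower Z) (switch Z)"
  note D = planar_filippovD[OF planar]
  have se: "p \<in> sliding_set Z \<union> escaping_set Z"
    using sn by (simp add: saddle_node_pseudo_equilibrium_def)
  then have p: "p \<in> Sigma_set Z" by (auto simp: sliding_set_def escaping_set_def)
  then have pD: "p \<in> region Z" "p $ 2 = 0" using Sigma_set_eq[OF planar(1)] by auto
  have lie0: "?U p \<noteq> 0" "?L p \<noteq> 0" using se by (auto simp: sliding_set_def escaping_set_def)
  have "Ck_on 2 ?U (region Z)" "Ck_on 2 ?L (region Z)"
    using D(2) by (intro Ck_on_lie D; simp add: numeral_3_eq_3 numeral_2_eq_2)+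
  then have cont: "continuous_on (region Z) ?U" "continuous_on (region Z) ?L"
    by (auto intro: Ck_on_imp_continuous_on)
  have evU: "\<forall>\<^sub>F s in at (p $ 1). ?U (on_axis s) \<noteq> 0" and evL: "\<forall>\<^sub>F s in at (p $ 1). ?L (on_axis s) \<noteq> 0"
    using eventually_on_axis[OF eventually_nonzero[OF cont(1) D(1) pD(1) lie0(1)] pD(2)]
      eventually_on_axis[OF eventually_nonzero[OF cont(2) D(1) pD(1) lie0(2)] pD(2)]
    by (simp_all add: eventually_nhds_conv_at)
  obtain c where c: "c \<noteq> 0" "\<forall>\<^sub>F s in at (p $ 1). c * sliding_scalar Z s > 0"
    by (rule saddle_node_sliding_sign[OF planar sn])
  show ?thesis
  proof (rule isolating_radius_exists[OF planar p])
    have "sliding_field Z p $ 1 = 0"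
      using sn on_axis_eqI[OF pD(2)] by (simp add: saddle_node_pseudo_equilibrium_def sliding_scalar_def)
    then have "sliding_field Z p = 0"
      using sliding_field_snd[OF planar pD] by (intro plane_eqI) auto
    then show "singularity Z p" using se by (auto simp: singularity_def)
    show "upper Z p \<noteq> 0" "lower Z p \<noteq> 0" using lie0 by (auto simp: lie_def)
    show "\<forall>\<^sub>F s in at (p $ 1). \<not> singularity Z (on_axis s)"
      using evU evL c(2)
    proof eventually_elim
      case (elim s)
      have "upper Z (on_axis s) \<noteq> 0" "lower Z (on_axis s) \<noteq> 0"
        using elim by (auto simp: lie_def)
      moreover have "sliding_field Z (on_axis s) \<noteq> 0" using elim(3) by (auto simp: sliding_scalar_def)
      ultimately show ?case using elim by (auto simp: singularity_def)
    qed
  qed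
qed

text \<open>All points of the diameter slide, or all escape, because the Lie derivatives have no zeros on it.
Consequently the scalar sliding field \<open>s\<close> satisfies
\<open>s (F\<^sup>- f - F\<^sup>+ f) = - f\<^sub>y det (F\<^sup>-|F\<^sup>+)\<close> with factors of constant sign, and \<open>det (F\<^sup>-|F\<^sup>+)\<close> is a positive
multiple of the imaginary part of \<open>F\<^sup>+ / F\<^sup>-\<close>. As \<open>s\<close> has the same sign on both sides of \<open>p\<close>, this
quotient stays in one closed half plane and is real only at \<open>p\<close>.\<close>
lemma saddle_node_index:
  assumes planar: "planar_filippov l Z" "l \<ge> 3" and sn: "saddle_node_pseudo_equilibrium Z p"
    and r: "isolating_radius Z p r"
  shows "circle_index Z p r = 0"
proof -
  let ?U = "\<lambda>s. lie (upper Z) (switch Z) (on_axis s)" and ?L = "\<lambda>s. lie (lower Z) (switch Z) (on_axis s)"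
  let ?g = "sliding_scalar Z"
  define a where "a = p $ 1"
  define I where "I = {a - r..a + r}"
  note D = planar_filippovD[OF planar]
  have se: "p \<in> sliding_set Z \<union> escaping_set Z"
    using sn by (simp add: saddle_node_pseudo_equilibrium_def)
  then have p: "p \<in> Sigma_set Z" by (auto simp: sliding_set_def escaping_set_def)
  then have pD: "p \<in> region Z" "p $ 2 = 0" using Sigma_set_eq[OF planar(1)] by auto
  have axp: "on_axis a = p" unfolding a_def using pD(2) by (rule on_axis_eqI)
  have r': "r > 0" "cball p r \<subseteq> region Z" using r by (auto simp: isolating_radius_def)
  have aI: "a \<in> I" using r' by (simp add: I_def)
  have mem: "on_axis s \<in> cball p r" if "s \<in> I" for s
    using that dist_on_axis[OF pD(2), of s] by (auto simp: I_def a_def)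
  have reg: "on_axis s \<in> region Z" if "s \<in> I" for s using mem[OF that] r'(2) by blast
  then have Sig: "on_axis s \<in> Sigma_set Z" if "s \<in> I" for s
    using that Sigma_set_eq[OF planar(1)] by auto
  have ne: "on_axis s \<noteq> p" if "s \<noteq> a" for s using that by (auto simp: a_def)
  note ns = nonsingular_on_axis[OF Sig isolating_radius_nonsingular[OF r mem ne]]
  have lie0: "?U s \<noteq> 0" "?L s \<noteq> 0" if "s \<in> I" for s
    using that ns(3,4)[OF that that] se axp
    by (cases "s = a"; auto simp: sliding_set_def escaping_set_def)+
  have F0: "upper Z (on_axis s) \<noteq> 0" "lower Z (on_axis s) \<noteq> 0" if "s \<in> I" for s
    using lie0[OF that] unfolding lie_def by (metis inner_zero_right)+
  have nz: "upper Z p \<noteq> 0" "lower Z p \<noteq> 0" using F0[OF aI] by (simp_all add: axp)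
  have axI: "continuous_on I on_axis" by (rule continuous_on_on_axis)
  have comp: "continuous_on I (\<lambda>s. h (on_axis s))" if "continuous_on (region Z) h"
    for h :: "plane \<Rightarrow> 'b::real_normed_vector"
    by (rule continuous_on_compose2[OF that axI]) (use reg in auto)
  have CkUL: "Ck_on 2 (lie (upper Z) (switch Z)) (region Z)" "Ck_on 2 (lie (lower Z) (switch Z)) (region Z)"
    using D(2) by (intro Ck_on_lie D; simp add: numeral_3_eq_3 numeral_2_eq_2)+
  have cont: "continuous_on I ?U" "continuous_on I ?L" 
    "continuous_on I (\<lambda>s. upper Z (on_axis s) $ 1)" "continuous_on I (\<lambda>s. lower Z (on_axis s) $ 1)"
    by (intro comp Ck_on_imp_continuous_on[OF CkUL(1)] Ck_on_imp_continuous_on[OF CkUL(2)]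
        Ck_on_imp_continuous_on[OF Ck_on_component[OF D(1) D(3)]]
        Ck_on_imp_continuous_on[OF Ck_on_component[OF D(1) D(4)]])+
  have conn: "connected I" by (simp add: I_def)
  have UL: "?U s * ?L s < 0" if "s \<in> I" for s
  proof -
    have "(?U s * ?L s) * (?U a * ?L a) > 0"
      by (rule nonvanishing_same_sign[OF conn _ _ that aI]) (use lie0 in \<open>auto intro!: continuous_intros cont\<close>)
    moreover have "?U a * ?L a < 0"
      using se unfolding axp by (auto simp: sliding_set_def escaping_set_def mult_less_0_iff)
    ultimately show ?thesis by (metis zero_less_mult_iff order.asym)
  qed
  define W where "W s = ?L s - ?U s" for s
  have W0: "W s \<noteq> 0" if "s \<in> I" for s
    using UL[OF that] by (auto simp: W_def mult_less_0_iff)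
  have contW: "continuous_on I W" unfolding W_def by (intro continuous_intros cont)
  have WW: "W s * W a > 0" if "s \<in> I" for s
    by (rule nonvanishing_same_sign[OF conn contW W0 that aI])
  have se_I: "on_axis s \<in> sliding_set Z \<union> escaping_set Z" if "s \<in> I" for s
    using UL[OF that] Sig[OF that] by (auto simp: sliding_set_def escaping_set_def mult_less_0_iff)
  have g_eq: "?g s = (?L s * upper Z (on_axis s) $ 1 - ?U s * lower Z (on_axis s) $ 1) / W s" for s
    by (simp add: sliding_scalar_def sliding_field_def W_def divide_inverse mult.commute)
  have contg: "continuous_on I ?g"
    unfolding g_eq[abs_def] using W0 by (intro continuous_intros cont contW) auto
  have ga: "?g a = 0" using sn by (simp add: saddle_node_pseudo_equilibrium_def a_def)
  have g0: "?g s \<noteq> 0" if "s \<in> I" "s \<noteq> a" for s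
  proof
    assume "?g s = 0"
    then have "sliding_field Z (on_axis s) = 0"
      using sliding_field_snd[OF planar reg[OF that(1)]] by (intro plane_eqI) (auto simp: sliding_scalar_def)
    then show False using ns(5)[OF that(1,1,2) se_I[OF that(1)]] by simp
  qed
  obtain c where c: "c \<noteq> 0" "\<forall>\<^sub>F s in at a. c * ?g s > 0"
    unfolding a_def by (rule saddle_node_sliding_sign[OF planar sn])
  obtain d where d: "d > 0" "\<And>s. s \<noteq> a \<Longrightarrow> dist s a < d \<Longrightarrow> c * ?g s > 0"
    using c(2) unfolding eventually_at by auto
  \<comment> \<open>The sign near \<open>p\<close> spreads over each half of the diameter, where the sliding field has no zeros.\<close>
  have cg: "c * ?g s > 0" if s: "s \<in> I" "s \<noteq> a" for s
  proof -
    define J where "J = (if s > a then {a<..a + r} else {a - r..<a})"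
    define t where "t = (if s > a then a + min d r / 2 else a - min d r / 2)"
    have J: "connected J" "J \<subseteq> I" "a \<notin> J" "s \<in> J" "t \<in> J"
      using s r' d(1) by (auto simp: J_def I_def t_def min_def)
    have "?g s * ?g t > 0"
      by (rule nonvanishing_same_sign[OF J(1) continuous_on_subset[OF contg J(2)] _ J(4,5)])
         (use g0 J in auto)
    moreover have "c * ?g t > 0" using d(1) r' by (intro d(2)) (auto simp: t_def dist_real_def min_def)
    ultimately show ?thesis by (auto simp: zero_less_mult_iff)
  qed
  \<comment> \<open>The half plane that contains the quotient; the quotient \<open>z\<close> is then turned by \<open>- \<i> \<sigma>\<close> into the right half plane.\<close>
  define \<sigma> where "\<sigma> = - sgn (c * W a)"
  have \<sigma>: "\<sigma> = 1 \<or> \<sigma> = -1" using c(1) W0[OF aI] by (auto simp: \<sigma>_def sgn_if)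
  have Im: "\<exists>k>0. Im (ratio Z (on_axis s)) = - (?g s * W s) * k" if "s \<in> I" for s
  proof -
    let ?F = "upper Z (on_axis s)" and ?G = "lower Z (on_axis s)"
    define m where "m = partial 2 (switch Z) (on_axis s)"
    have m: "m > 0" unfolding m_def by (rule switch_partials(2)[OF planar reg[OF that]]) simp
    have lie: "lie F (switch Z) (on_axis s) = m * F (on_axis s) $ 2" for F
      unfolding m_def by (rule lie_switch_eq[OF planar reg[OF that]]) simp
    have n: "(?G $ 1)\<^sup>2 + (?G $ 2)\<^sup>2 > 0"
      using F0(2)[OF that] by (auto simp: vec_eq_iff forall_2 sum_power2_gt_zero_iff)
    have "?g s * W s = ?L s * ?F $ 1 - ?U s * ?G $ 1" using W0[OF that] by (simp add: g_eq)
    also have "\<dots> = - m * det_cols ?G ?F" by (simp add: lie det_cols_eq algebra_simps)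
    finally have "Im (ratio Z (on_axis s)) = - (?g s * W s) * (1 / (m * ((?G $ 1)\<^sup>2 + (?G $ 2)\<^sup>2)))"
      using m n unfolding Im_cplx_divide by simp
    then show ?thesis
      using m n by (intro exI[of _ "1 / (m * ((?G $ 1)\<^sup>2 + (?G $ 2)\<^sup>2))"] conjI) auto
  qed
  have pos: "\<sigma> * Im (ratio Z (on_axis s)) > 0" if s: "s \<in> I" "s \<noteq> a" for s
  proof -
    obtain k where k: "k > 0" "Im (ratio Z (on_axis s)) = - (?g s * W s) * k" using Im[OF s(1)] by auto
    have "(c * ?g s) * (W s * W a) > 0" using cg[OF s] WW[OF s(1)] by simp
    then have "(c * W a) * (?g s * W s) > 0" by (simp add: mult_ac)
    then have "sgn (c * W a) * (?g s * W s) > 0"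
      by (auto simp: sgn_if zero_less_mult_iff mult_less_0_iff)
    from mult_pos_pos[OF this k(1)] show ?thesis by (simp add: k(2) \<sigma>_def mult.assoc)
  qed
  have rot: "Re (- \<i> * of_real \<sigma> * z) = \<sigma> * Im z" "Im (- \<i> * of_real \<sigma> * z) = - \<sigma> * Re z" for z
    by simp_all
  have not_nonpos: "- \<i> * of_real \<sigma> * ratio Z (on_axis s) \<notin> \<real>\<^sub>\<le>\<^sub>0" if "s \<in> I" for s
  proof (cases "s = a")
    case False
    then show ?thesis using pos[OF that] unfolding complex_nonpos_Reals_iff rot by linarith
  next
    case True
    have "Im (ratio Z (on_axis s)) = 0" using Im[OF that] ga True by auto
    moreover have "ratio Z (on_axis s) \<noteq> 0" using F0[OF that] by simp
    ultimately have "Re (ratio Z (on_axis s)) \<noteq> 0" by (metis complex_eqI zero_complex.sel)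
    then show ?thesis using \<sigma> unfolding complex_nonpos_Reals_iff rot by auto
  qed
  show ?thesis
  proof (rule circle_index_eq_0[OF planar(1) _ pD(2) r nz, where c = "- \<i> * of_real \<sigma>" and d = "- \<sigma> * (pi / 2)"])
    show "l \<ge> 1" using planar by simp
    show "- \<i> * of_real \<sigma> * ratio Z (on_axis x) \<notin> \<real>\<^sub>\<le>\<^sub>0" if "x \<in> {p $ 1 - r..p $ 1 + r}" for x
      using that by (intro not_nonpos) (simp add: I_def a_def)
    fix x assume "x \<in> {p $ 1 - r, p $ 1 + r}"
    then have x: "x \<in> I" "x \<noteq> a" using r'(1) by (auto simp: I_def a_def)
    have "ratio Z (on_axis x) \<notin> \<real>\<^sub>\<le>\<^sub>0" using pos[OF x] by (auto simp: complex_nonpos_Reals_iff)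
    then show "ratio Z (on_axis x) \<notin> \<real>\<^sub>\<le>\<^sub>0 \<and> Im (Ln (- \<i> * of_real \<sigma> * ratio Z (on_axis x))) =
        Arg (ratio Z (on_axis x)) + - \<sigma> * (pi / 2)"
      using Im_Ln_rotate_half_plane[OF \<sigma> pos[OF x]] by simp
  qed
qed

theorem proposition12:
  fixes Z :: filippov and p :: plane and l :: nat
  assumes "planar_filippov l Z"
    and "l \<ge> 3"
    and "p \<in> Sigma_set Z"
    and "regular_cusp Z p \<or> saddle_node_pseudo_equilibrium Z p"
  shows "has_index_at Z p 0"
  using assms(4) regular_cusp_isolating_radius[OF assms(1,2)] regular_cusp_index[OF assms(1,2)]
    saddle_node_isolating_radius[OF assms(1,2)] saddle_node_index[OF assms(1,2)]
  unfolding has_index_at_def by blast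

end
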